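(* Let $m,n$ be positive integers. For each integer $k$ with $0\le k\le n$, the number of elements of $\mathcal{D}_n^{\mathrm{gen}(m)}$ with exactly $k$ ones is $$\frac{n+1-k}{n+1}\binom{(n+1)m}{k},$$ and the size of $\mathcal{D}_n^{\mathrm{gen}(m)}$ is $$\binom{(n+1)m-1}{n}-(m-2)\sum_{k=0}^{n-1}\binom{(n+1)m-1}{k}.$$
   Context: For a polynomial $P\in\mathbb{C}[x]$ of degree exactly $n$ and an $m$-tuple $\Lambda=(\lambda_1,\ldots,\lambda_m)$ of distinct complex numbers, the dope matrix $D_P(\Lambda)$ is the $m\times(n+1)$ matrix $(c_{ij})$, with rows indexed by $i\in\{1,\ldots,m\}$ and columns indexed by $j\in\{0,1,\ldots,n\}$, where $c_{ij}=1$ if $P^{(j)}(\lambda_i)=0$ and $c_{ij}=0$ otherwise. For fixed $\Lambda$ and $n$ put $\mathcal{D}_n(\Lambda)=\{D_P(\Lambda): P\in\mathbb{C}[x],\ \deg P=n\}$. An affine algebraic dependence of $\Lambda$ is a polynomial $R\in\mathbb{Q}[x_1,\ldots,x_m]$ with $R(a+b\lambda_1,\ldots,a+b\lambda_m)=0$ for all $a,b\in\mathbb{C}$. $\Lambda$ is affinely algebraically independent if its only affine algebraic dependence is $R\equiv 0$. The set $\mathcal{D}_n(\Lambda)$ is the same for every affinely algebraically independent $m$-tuple $\Lambda$, and this common set is denoted $\mathcal{D}_n^{\mathrm{gen}(m)}$. *)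

theory Defs
  imports
    Complex_Main
    "HOL-Library.Poly_Mapping"
    "HOL-Computational_Algebra.Polynomial"
    "Jordan_Normal_Form.Matrix"
begin

text \<open>
  An $m$-tuple of complex numbers is a list of length $m$; rows and variables are numbered from
  $0$ to $m - 1$. Columns are numbered from $0$ to $n$, column $j$ belonging to the $j$-th
  derivative.
\<close>

definition dope_matrix :: "complex poly \<Rightarrow> complex list \<Rightarrow> nat mat" where
  "dope_matrix P \<Lambda> =
     mat (length \<Lambda>) (degree P + 1)
       (\<lambda>(i, j). if poly ((pderiv ^^ j) P) (\<Lambda> ! i) = 0 then 1 else 0)"

text \<open>The zero polynomial has \<open>degree 0 = 0\<close> in the library, hence the condition \<open>P \<noteq> 0\<close>.\<close>

definition dope_set :: "nat \<Rightarrow> complex list \<Rightarrow> nat mat set" where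
  "dope_set n \<Lambda> = {dope_matrix P \<Lambda> | P. P \<noteq> 0 \<and> degree P = n}"

definition num_ones :: "nat mat \<Rightarrow> nat" where
  "num_ones M = card {(i, j). i < dim_row M \<and> j < dim_col M \<and> M $$ (i, j) = 1}"

text \<open>
  A polynomial in countably many variables over the rationals is a finitely supported map from
  monomials to coefficients, a monomial being a finitely supported map from variables to
  exponents. The ring $\mathbb{Q}[x_0, \ldots, x_{m-1}]$ consists of those that only involve
  variables below $m$.
\<close>

type_synonym rat_mpoly = "(nat \<Rightarrow>\<^sub>0 nat) \<Rightarrow>\<^sub>0 rat"

definition mpolys_in :: "nat \<Rightarrow> rat_mpoly set" where
  "mpolys_in m = {R. \<forall>u \<in> Poly_Mapping.keys R. Poly_Mapping.keys u \<subseteq> {..<m}}"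

definition eval_mpoly :: "rat_mpoly \<Rightarrow> (nat \<Rightarrow> complex) \<Rightarrow> complex" where
  "eval_mpoly R x =
     (\<Sum>u \<in> Poly_Mapping.keys R. of_rat (Poly_Mapping.lookup R u) *
        (\<Prod>i \<in> Poly_Mapping.keys u. x i ^ Poly_Mapping.lookup u i))"

definition affine_alg_dependence :: "complex list \<Rightarrow> rat_mpoly \<Rightarrow> bool" where
  "affine_alg_dependence \<Lambda> R \<longleftrightarrow>
     R \<in> mpolys_in (length \<Lambda>) \<and> (\<forall>a b. eval_mpoly R (\<lambda>i. a + b * \<Lambda> ! i) = 0)"

definition affine_alg_independent :: "complex list \<Rightarrow> bool" where
  "affine_alg_independent \<Lambda> \<longleftrightarrow> (\<forall>R. affine_alg_dependence \<Lambda> R \<longrightarrow> R = 0)"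

text \<open>
  The set shared by all affinely algebraically independent $m$-tuples of distinct numbers. Such
  tuples exist for every $m$ and all yield the same set, so the description is proper.
\<close>

definition dope_gen :: "nat \<Rightarrow> nat \<Rightarrow> nat mat set" where
  "dope_gen n m =
     (THE D. \<forall>\<Lambda>. length \<Lambda> = m \<and> distinct \<Lambda> \<and> affine_alg_independent \<Lambda> \<longrightarrow> dope_set n \<Lambda> = D)"

end

theory Submission
  imports Defs "Jordan_Normal_Form.Determinant" "HOL-Analysis.Continuum_Not_Denumerable"
begin

text \<open>
  Record a dope matrix by the set of its ones, a set \<open>S\<close> of pairs (node, order of derivative). The
  proof identifies the generic dope matrices with the sets \<open>S\<close> that have at most \<open>n - t\<close> elements
  of order at least \<open>t\<close>, for every \<open>t \<le> n\<close> (\<open>dope_set_generic\<close>), and counts these sets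
  (\<open>card_admissible\<close>).
  
  Both inclusions of the identification rest on one fact about Birkhoff interpolation
  (\<open>affine_alg_independent_unisolvent\<close>): if \<open>N\<close> conditions \<open>P\<^sup>(\<^sup>j\<^sup>)(\<lambda>\<^sub>i) = 0\<close> contain at most \<open>N - t\<close>
  conditions of order at least \<open>t\<close>, for every \<open>t\<close>, then only the zero polynomial of degree below
  \<open>N\<close> satisfies them, provided that \<open>\<Lambda>\<close> is affinely algebraically independent. The determinant of
  the conditions is a polynomial in the nodes with rational coefficients, and its vanishing is
  invariant under affine maps of the nodes. If it vanished at \<open>\<Lambda>\<close>, it would be an affine algebraic
  dependence, hence zero. So it suffices to find one tuple of nodes at which it does not vanish
  (\<open>exists_unisolvent_nodes\<close>). Nodes are added one at a time, each new node at a small distance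
  \<open>\<epsilon>\<close> from the point 0, and the space of polynomials is spanned by the monomials \<open>x\<^sup>k\<close> with
  \<open>k\<close> in a set \<open>K\<close>. The conditions at the new node determine the coefficients with exponents in a
  set \<open>A \<subseteq> K\<close> chosen greedily, and in the limit \<open>\<epsilon> \<rightarrow> 0\<close> the remaining conditions become those for
  the exponents \<open>K - A\<close>. That the new conditions do determine these coefficients is interpolation
  at only two points, 0 and 1, where Rolle's theorem suffices (\<open>two_point_interpolation\<close>).
  
  If \<open>P\<close> of degree \<open>n\<close> had too many zeros of order at least \<open>t\<close>, for the largest such \<open>t\<close>, then
  \<open>n - t + 1\<close> of them would be a unisolvent set of conditions on \<open>P\<^sup>(\<^sup>t\<^sup>)\<close>, which is not zero.
  Conversely, an admissible \<open>S\<close> stays within the interpolation bounds when a further position is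
  added, so some polynomial vanishes on \<open>S\<close> but not at that position, and a generic linear
  combination of such polynomials has exactly the zeros \<open>S\<close>.
  
  For the count, deleting the column of order 0 gives a recursion in the number of columns that
  Vandermonde's identity solves.
\<close>

section \<open>Homogeneous linear systems\<close>

text \<open>
  The Leibniz expansion of the determinant of a square system whose rows \<open>S\<close> and columns \<open>K\<close> are
  arbitrary finite sets; \<open>\<Phi>\<close> consists of bijections from \<open>S\<close> to \<open>K\<close>. The explicit sum of products
  shows that it is continuous when the entries vary continuously, and a rational polynomial in the
  nodes when they are rational multiples of monomials in the nodes.
\<close>

lemma kernel_det_expansion:
  fixes S :: "'a set" and K :: "'b set"
  assumes "finite S" "finite K" "card S = card K"
  obtains \<Phi> :: "('a \<Rightarrow> 'b) set" and s :: "('a \<Rightarrow> 'b) \<Rightarrow> int"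
  where "finite \<Phi>"
    and "\<And>w :: 'a \<Rightarrow> 'b \<Rightarrow> complex.
      (\<Sum>\<phi>\<in>\<Phi>. of_int (s \<phi>) * (\<Prod>c\<in>S. w c (\<phi> c))) = 0 \<longleftrightarrow>
      (\<exists>p. (\<exists>k\<in>K. p k \<noteq> 0) \<and> (\<forall>c\<in>S. (\<Sum>k\<in>K. w c k * p k) = 0))"
proof -
  define n where "n = card S"
  obtain e where e: "bij_betw e {0..<n} S"
    using ex_bij_betw_nat_finite[OF assms(1)] unfolding n_def by blast
  obtain f where f: "bij_betw f {0..<n} K"
    using ex_bij_betw_nat_finite[OF assms(2)] assms(3) unfolding n_def by metis
  define e' where "e' = the_inv_into {0..<n} e"
  define f' where "f' = the_inv_into {0..<n} f"
  have e'e: "e' (e i) = i" if "i < n" for i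
    using that e unfolding e'_def by (simp add: bij_betw_def the_inv_into_f_f)
  have f'f: "f' (f i) = i" if "i < n" for i
    using that f unfolding f'_def by (simp add: bij_betw_def the_inv_into_f_f)
  define F where "F = (\<lambda>\<pi> c. f (\<pi> (e' c)))"
  define Perm where "Perm = {\<pi>. \<pi> permutes {0..<n}}"
  have finP: "finite Perm"
    unfolding Perm_def by (rule finite_permutations) simp
  have inj: "inj_on F Perm"
  proof (rule inj_onI)
    fix \<pi> \<tau> assume P: "\<pi> \<in> Perm" "\<tau> \<in> Perm" and eq: "F \<pi> = F \<tau>"
    show "\<pi> = \<tau>"
    proof
      fix i
      show "\<pi> i = \<tau> i"
      proof (cases "i < n")
        case True
        have "F \<pi> (e i) = F \<tau> (e i)" using eq by simp
        then have "f (\<pi> i) = f (\<tau> i)" using True by (simp add: F_def e'e)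
        moreover have "\<pi> i < n" "\<tau> i < n"
          using P True permutes_in_image[of \<pi> "{0..<n}" i] permutes_in_image[of \<tau> "{0..<n}" i]
          unfolding Perm_def by auto
        ultimately show ?thesis using f'f by metis
      next
        case False
        then show ?thesis
          using P unfolding Perm_def by (simp add: permutes_def)
      qed
    qed
  qed
  define s where "s = (\<lambda>\<phi>. signof (the_inv_into Perm F \<phi>) :: int)"
  have main: "(\<Sum>\<phi>\<in>F ` Perm. of_int (s \<phi>) * (\<Prod>c\<in>S. w c (\<phi> c))) = 0 \<longleftrightarrow>
      (\<exists>p. (\<exists>k\<in>K. p k \<noteq> 0) \<and> (\<forall>c\<in>S. (\<Sum>k\<in>K. w c k * p k) = 0))"
    for w :: "'a \<Rightarrow> 'b \<Rightarrow> complex"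
  proof -
    define A where "A = mat n n (\<lambda>(i, j). w (e i) (f j))"
    have A: "A \<in> carrier_mat n n" by (simp add: A_def)
    have "(\<Sum>\<phi>\<in>F ` Perm. of_int (s \<phi>) * (\<Prod>c\<in>S. w c (\<phi> c)))
        = (\<Sum>\<pi>\<in>Perm. of_int (s (F \<pi>)) * (\<Prod>c\<in>S. w c (F \<pi> c)))"
      using inj by (simp add: sum.reindex)
    also have "\<dots> = (\<Sum>\<pi>\<in>Perm. signof \<pi> * (\<Prod>i = 0..<n. A $$ (i, \<pi> i)))"
    proof (rule sum.cong[OF refl])
      fix \<pi> assume \<pi>: "\<pi> \<in> Perm"
      have "(\<Prod>c\<in>S. w c (F \<pi> c)) = (\<Prod>i = 0..<n. w (e i) (F \<pi> (e i)))"
        using prod.reindex_bij_betw[OF e, of "\<lambda>c. w c (F \<pi> c)"] by simp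
      also have "\<dots> = (\<Prod>i = 0..<n. A $$ (i, \<pi> i))"
      proof (rule prod.cong[OF refl])
        fix i assume "i \<in> {0..<n}"
        moreover have "\<pi> i < n"
          using \<pi> calculation permutes_in_image[of \<pi> "{0..<n}" i] unfolding Perm_def by auto
        ultimately show "w (e i) (F \<pi> (e i)) = A $$ (i, \<pi> i)"
          by (simp add: A_def F_def e'e)
      qed
      finally have pr: "(\<Prod>c\<in>S. w c (F \<pi> c)) = (\<Prod>i = 0..<n. A $$ (i, \<pi> i))" .
      have "s (F \<pi>) = signof \<pi>"
        using the_inv_into_f_f[OF inj \<pi>] by (simp add: s_def)
      then have "complex_of_int (s (F \<pi>)) = signof \<pi>"
        by (simp add: sign_def)
      then show "of_int (s (F \<pi>)) * (\<Prod>c\<in>S. w c (F \<pi> c)) =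
          signof \<pi> * (\<Prod>i = 0..<n. A $$ (i, \<pi> i))"
        using pr by simp
    qed
    also have "\<dots> = det A"
      unfolding Perm_def by (rule det_def'[OF A, symmetric])
    finally have D: "(\<Sum>\<phi>\<in>F ` Perm. of_int (s \<phi>) * (\<Prod>c\<in>S. w c (\<phi> c))) = det A" .
    have row: "(A *\<^sub>v v) $ i = (\<Sum>k\<in>K. w (e i) k * v $ f' k)" if "i < n" "v \<in> carrier_vec n" for v i
    proof -
      have "(A *\<^sub>v v) $ i = (\<Sum>j = 0..<n. w (e i) (f j) * v $ j)"
        using that by (simp add: A_def scalar_prod_def)
      also have "\<dots> = (\<Sum>j = 0..<n. w (e i) (f j) * v $ f' (f j))"
        by (rule sum.cong) (auto simp: f'f)
      also have "\<dots> = (\<Sum>k\<in>K. w (e i) k * v $ f' k)"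
        using sum.reindex_bij_betw[OF f, of "\<lambda>k. w (e i) k * v $ f' k"] by simp
      finally show ?thesis .
    qed
    have "(\<exists>v. v \<in> carrier_vec n \<and> v \<noteq> 0\<^sub>v n \<and> A *\<^sub>v v = 0\<^sub>v n) \<longleftrightarrow>
      (\<exists>p. (\<exists>k\<in>K. p k \<noteq> 0) \<and> (\<forall>c\<in>S. (\<Sum>k\<in>K. w c k * p k) = 0))"
      (is "?L \<longleftrightarrow> ?R")
    proof
      assume ?L
      then obtain v where v: "v \<in> carrier_vec n" "v \<noteq> 0\<^sub>v n" "A *\<^sub>v v = 0\<^sub>v n" by blast
      then obtain i where i: "i < n" "v $ i \<noteq> 0"
        by (metis carrier_vecD eq_vecI index_zero_vec(1) index_zero_vec(2))
      have "f i \<in> K" using f i by (auto simp: bij_betw_def)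
      moreover have "v $ f' (f i) \<noteq> 0" using i f'f by simp
      moreover have "(\<Sum>k\<in>K. w c k * v $ f' k) = 0" if "c \<in> S" for c
      proof -
        obtain i where "i < n" "c = e i" using \<open>c \<in> S\<close> e by (auto simp: bij_betw_def)
        then show ?thesis using row[of i v] v by simp
      qed
      ultimately show ?R by (intro exI[of _ "\<lambda>k. v $ f' k"]) blast
    next
      assume ?R
      then obtain p k where p: "k \<in> K" "p k \<noteq> 0" "\<And>c. c \<in> S \<Longrightarrow> (\<Sum>k\<in>K. w c k * p k) = 0" by blast
      define v where "v = vec n (\<lambda>i. p (f i))"
      have vf: "v $ f' k = p k" if "k \<in> K" for k
      proof -
        obtain i where "i < n" "k = f i" using \<open>k \<in> K\<close> f by (auto simp: bij_betw_def)
        then show ?thesis by (simp add: v_def f'f)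
      qed
      have f'k: "f' k < n"
      proof -
        obtain i where "i < n" "k = f i" using \<open>k \<in> K\<close> f by (auto simp: bij_betw_def)
        then show ?thesis by (simp add: f'f)
      qed
      have vc: "v \<in> carrier_vec n" by (simp add: v_def)
      moreover have "v \<noteq> 0\<^sub>v n"
        using vf[OF p(1)] p(2) f'k by auto
      moreover have "A *\<^sub>v v = 0\<^sub>v n"
      proof (rule eq_vecI)
        fix i assume "i < dim_vec (0\<^sub>v n :: complex vec)"
        then have i: "i < n" by simp
        then have "e i \<in> S" using e by (auto simp: bij_betw_def)
        then show "(A *\<^sub>v v) $ i = 0\<^sub>v n $ i"
          using row[OF i vc] p(3)[of "e i"] vf i by simp
      qed (simp add: A_def)
      ultimately show ?L by blast
    qed
    then show ?thesis
      using D det_0_iff_vec_prod_zero_field[OF A] by simp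
  qed
  show ?thesis
    by (rule that[of "F ` Perm" s]) (use finP main in auto)
qed

text \<open>
  Padded with zero rows, the system becomes square, and every product in the expansion of its
  determinant contains a factor 0.
\<close>

lemma underdetermined_system_has_solution:
  fixes w :: "'a \<Rightarrow> nat \<Rightarrow> complex"
  assumes "finite S" "finite K" "card S < card K"
  shows "\<exists>p. (\<exists>k\<in>K. p k \<noteq> 0) \<and> (\<forall>c\<in>S. (\<Sum>k\<in>K. w c k * p k) = 0)"
proof -
  define T where "T = Inl ` S \<union> Inr ` {..<card K - card S}"
  have finT: "finite T"
    using assms by (simp add: T_def)
  have "card T = card (Inl ` S :: ('a + nat) set) + card (Inr ` {..<card K - card S} :: ('a + nat) set)"
    unfolding T_def using assms by (intro card_Un_disjoint) auto
  then have cT: "card T = card K"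
    using assms by (simp add: card_image)
  obtain \<Phi> s where fin: "finite \<Phi>" and det: "\<And>w :: 'a + nat \<Rightarrow> nat \<Rightarrow> complex.
      (\<Sum>\<phi>\<in>\<Phi>. of_int (s \<phi>) * (\<Prod>c\<in>T. w c (\<phi> c))) = 0 \<longleftrightarrow>
      (\<exists>p. (\<exists>k\<in>K. p k \<noteq> 0) \<and> (\<forall>c\<in>T. (\<Sum>k\<in>K. w c k * p k) = 0))"
    using kernel_det_expansion[OF finT assms(2) cT] by blast
  define w' where "w' = case_sum w (\<lambda>(_ :: nat) _. 0)"
  have "Inr 0 \<in> T" using assms(3) unfolding T_def by auto
  then have "(\<Prod>c\<in>T. w' c (\<phi> c)) = 0" for \<phi>
    using finT by (intro prod_zero) (auto simp: w'_def intro!: bexI[of _ "Inr 0"])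
  then have "(\<Sum>\<phi>\<in>\<Phi>. of_int (s \<phi>) * (\<Prod>c\<in>T. w' c (\<phi> c))) = 0" by simp
  then obtain p k where "k \<in> K" "p k \<noteq> 0" and p: "\<forall>c\<in>T. (\<Sum>k\<in>K. w' c k * p k) = 0"
    using det by blast
  moreover have "(\<Sum>k\<in>K. w c k * p k) = 0" if "c \<in> S" for c
  proof -
    have "Inl c \<in> T" using that unfolding T_def by simp
    with p have "(\<Sum>k\<in>K. w' (Inl c) k * p k) = 0" by blast
    then show ?thesis by (simp add: w'_def)
  qed
  ultimately show ?thesis by blast
qed

section \<open>Interpolation at two points\<close>

lemma poly_higher_pderiv:
  fixes P :: "'a::field_char_0 poly"
  assumes "degree P < N"
  shows "poly ((pderiv ^^ j) P) x =
    fact j * (\<Sum>k<N. of_nat (k choose j) * x ^ (k - j) * coeff P k)"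
proof -
  have mono: "poly ((pderiv ^^ j) (monom c k)) x = fact j * (of_nat (k choose j) * x ^ (k - j) * c)"
    for c :: 'a and k
  proof (induction j arbitrary: k c)
    case 0
    then show ?case by (simp add: poly_monom)
  next
    case (Suc j)
    have "poly ((pderiv ^^ Suc j) (monom c k)) x = poly ((pderiv ^^ j) (pderiv (monom c k))) x"
      by (simp only: funpow_Suc_right o_apply)
    also have "\<dots> = poly ((pderiv ^^ j) (monom (of_nat k * c) (k - 1))) x"
      by (simp add: pderiv_monom)
    also have "\<dots> = fact j * (of_nat ((k - 1) choose j) * x ^ (k - 1 - j) * (of_nat k * c))"
      by (rule Suc)
    also have "\<dots> = fact j * of_nat (k * ((k - 1) choose j)) * x ^ (k - 1 - j) * c"
      by (simp add: algebra_simps)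
    also have "k * ((k - 1) choose j) = Suc j * (k choose Suc j)"
      by (cases k) (simp_all only: Suc_times_binomial diff_Suc_1 diff_0_eq_0 mult_0 binomial_0_Suc mult_0_right)
    finally show ?case by (simp add: algebra_simps)
  qed
  have "P = (\<Sum>k<N. monom (coeff P k) k)"
    using poly_as_sum_of_monoms'[of P "N - 1"] assms
    by (cases N) (simp_all add: lessThan_Suc_atMost)
  then have "poly ((pderiv ^^ j) P) x = (\<Sum>k<N. poly ((pderiv ^^ j) (monom (coeff P k) k)) x)"
    by (metis (no_types, lifting) higher_pderiv_sum poly_sum sum.cong)
  then show ?thesis by (simp add: mono sum_distrib_left)
qed

text \<open>
  Locating the new zeros strictly between the extreme old ones keeps them distinct from zeros that
  are prescribed at the end points of an interval.
\<close>

lemma poly_roots_rolle: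
  fixes Q :: "real poly"
  assumes "finite Z" "Z \<noteq> {}" "\<And>z. z \<in> Z \<Longrightarrow> poly Q z = 0"
  shows "\<exists>Z'. finite Z' \<and> Suc (card Z') = card Z \<and> Z' \<subseteq> {Min Z<..<Max Z} \<and>
    (\<forall>z\<in>Z'. poly (pderiv Q) z = 0)"
  using assms
proof (induction Z rule: finite_linorder_max_induct)
  case empty
  then show ?case by simp
next
  case (insert b A)
  show ?case
  proof (cases "A = {}")
    case True
    then show ?thesis by (intro exI[of _ "{}"]) auto
  next
    case False
    then obtain Z' where Z': "finite Z'" "Suc (card Z') = card A" "Z' \<subseteq> {Min A<..<Max A}"
      "\<forall>z\<in>Z'. poly (pderiv Q) z = 0"
      using insert by auto
    have lt: "Max A < b" using False insert by simp
    have "poly Q (Max A) = poly Q b" using insert.prems False insert.hyps(1) Max_in by simp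
    have "\<exists>z. Max A < z \<and> z < b \<and> DERIV (poly Q) z :> 0"
      by (rule Rolle[OF lt])
        (use \<open>poly Q (Max A) = poly Q b\<close> in \<open>auto intro!: continuous_intros poly_differentiable\<close>)
    then obtain z where z: "Max A < z" "z < b" "DERIV (poly Q) z :> 0" by blast
    have "poly (pderiv Q) z = 0" using z(3) poly_DERIV DERIV_unique by blast
    moreover have "z \<notin> Z'" using Z' z by auto
    moreover have le: "Min A \<le> Max A" using False insert by simp
    moreover have "Min (insert b A) = Min A"
      using Min_insert[OF insert.hyps(1) False, of b] lt le by simp
    moreover have "Max (insert b A) = b"
      using Max_insert[OF insert.hyps(1) False, of b] lt by simp
    moreover have "b \<notin> A" using insert by blast
    ultimately show ?thesis using Z' z insert.hyps(1) lt
      by (intro exI[of _ "insert z Z'"]) fastforce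
  qed
qed

text \<open>
  Polya's theorem for the nodes 0 and 1. The polynomial \<open>Q = \<Sum>a\<in>A. p a x\<^sup>a\<close> satisfies \<open>Q\<^sup>(\<^sup>k\<^sup>)(0) = 0\<close>
  for \<open>k \<notin> A\<close> and \<open>Q\<^sup>(\<^sup>k\<^sup>)(1) = 0\<close> for \<open>k \<in> J\<close>. Each differentiation loses one zero by Rolle's theorem
  and gains those prescribed at the two ends, so the domination of \<open>A\<close> by \<open>J\<close> leaves
  every derivative of \<open>Q\<close> with a zero, which is impossible for the derivative of order \<open>degree Q\<close>
  unless \<open>Q = 0\<close>.
\<close>

lemma two_point_interpolation_real:
  fixes p :: "nat \<Rightarrow> real"
  assumes "finite A" "finite J"
    and dom: "\<And>t. card {a\<in>A. a < t} \<le> card {j\<in>J. j < t}"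
    and eqs: "\<And>j. j \<in> J \<Longrightarrow> (\<Sum>a\<in>A. of_nat (a choose j) * p a) = 0"
    and "a \<in> A"
  shows "p a = 0"
proof -
  define Q where "Q = (\<Sum>a\<in>A. monom (p a) a)"
  have coeffQ: "coeff Q k = (if k \<in> A then p k else 0)" for k
    using assms(1) by (simp add: Q_def coeff_sum if_distrib cong: if_cong)
  have at0: "poly ((pderiv ^^ k) Q) 0 = 0" if "k \<notin> A" for k
    using that by (simp add: poly_0_coeff_0 coeff_higher_pderiv coeffQ)
  have at1: "poly ((pderiv ^^ k) Q) 1 = 0" if "k \<in> J" for k
  proof -
    define N where "N = Suc (max (degree Q) (Max A))"
    have "a < N" if "a \<in> A" for a using Max_ge[OF assms(1) that] by (simp add: N_def)
    then have AN: "A \<subseteq> {..<N}" by auto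
    have "poly ((pderiv ^^ k) Q) 1 = fact k * (\<Sum>i<N. of_nat (i choose k) * coeff Q i)"
      by (subst poly_higher_pderiv[of _ N]) (auto simp: N_def)
    also have "(\<Sum>i<N. of_nat (i choose k) * coeff Q i) = (\<Sum>i\<in>A. of_nat (i choose k) * p i)"
      by (rule sum.mono_neutral_cong_right) (use AN in \<open>auto simp: coeffQ\<close>)
    finally show ?thesis using eqs[OF that] by simp
  qed
  have "Q = 0"
  proof (rule ccontr)
    assume "Q \<noteq> 0"
    \<comment> \<open>Below order \<open>k + 1\<close> at least \<open>1 + k\<close> zeros are prescribed at 0 and 1, and Rolle's theorem loses only \<open>k\<close> of them.\<close>
    have zeros: "\<exists>Z. finite Z \<and> Z \<subseteq> {0..1} \<and> (\<forall>z\<in>Z. poly ((pderiv ^^ k) Q) z = 0) \<and>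
       card Z + card {a\<in>A. a < Suc k} \<ge> 1 + card {j\<in>J. j < Suc k}" for k
    proof (induction k)
      case 0
      have "{a\<in>A. a < Suc 0} = (if 0 \<in> A then {0} else {})" "{j\<in>J. j < Suc 0} = (if 0 \<in> J then {0} else {})"
        by auto
      moreover have "card {0, 1 :: real} = 2" by simp
      ultimately show ?case using at0[of 0] at1[of 0]
        by (intro exI[of _ "(if 0 \<in> A then {} else {0}) \<union> (if 0 \<in> J then {1} else {})"]) auto
    next
      case (Suc k)
      then obtain Z where Z: "finite Z" "Z \<subseteq> {0..1}" "\<forall>z\<in>Z. poly ((pderiv ^^ k) Q) z = 0"
        and cZ: "card Z + card {a\<in>A. a < Suc k} \<ge> 1 + card {j\<in>J. j < Suc k}" by blast
      have "card Z \<noteq> 0" using cZ dom[of "Suc k"] by linarith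
      then have "Z \<noteq> {}" by auto
      obtain Z' where Z': "finite Z'" "Suc (card Z') = card Z" "Z' \<subseteq> {Min Z<..<Max Z}"
        "\<forall>z\<in>Z'. poly (pderiv ((pderiv ^^ k) Q)) z = 0"
        using poly_roots_rolle[OF Z(1) \<open>Z \<noteq> {}\<close>, of "(pderiv ^^ k) Q"] Z(3) by blast
      have mm: "0 \<le> Min Z" "Max Z \<le> 1" using Z(1,2) \<open>Z \<noteq> {}\<close> by (auto simp: subset_iff)
      have Z01: "Z' \<subseteq> {0<..<1}"
      proof
        fix z assume "z \<in> Z'"
        with Z'(3) have "Min Z < z" "z < Max Z" by auto
        with mm show "z \<in> {0<..<1}" by auto
      qed
      define E where "E = (if Suc k \<in> A then {} else {0}) \<union> (if Suc k \<in> J then {1} else {} :: real set)"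
      have A': "card {a\<in>A. a < Suc (Suc k)} = card {a\<in>A. a < Suc k} + (if Suc k \<in> A then 1 else 0)"
      proof -
        have "{a\<in>A. a < Suc (Suc k)} = {a\<in>A. a < Suc k} \<union> (if Suc k \<in> A then {Suc k} else {})"
          by (auto simp: less_Suc_eq)
        then show ?thesis using assms(1) by auto
      qed
      have J': "card {a\<in>J. a < Suc (Suc k)} = card {a\<in>J. a < Suc k} + (if Suc k \<in> J then 1 else 0)"
      proof -
        have "{a\<in>J. a < Suc (Suc k)} = {a\<in>J. a < Suc k} \<union> (if Suc k \<in> J then {Suc k} else {})"
          by (auto simp: less_Suc_eq)
        then show ?thesis using assms(2) by auto
      qed
      have "card E + (if Suc k \<in> A then 1 else 0) = 1 + (if Suc k \<in> J then 1 else 0)"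
        by (auto simp: E_def)
      moreover have "card (Z' \<union> E) = card Z' + card E"
        using Z01 Z'(1) by (intro card_Un_disjoint) (auto simp: E_def)
      ultimately have "card (Z' \<union> E) + card {a\<in>A. a < Suc (Suc k)} \<ge> 1 + card {j\<in>J. j < Suc (Suc k)}"
        using A' J' cZ Z'(2) by linarith
      moreover have "\<forall>z\<in>Z' \<union> E. poly ((pderiv ^^ Suc k) Q) z = 0"
        using Z'(4) at0[of "Suc k"] at1[of "Suc k"] by (auto simp: E_def)
      moreover have "Z' \<union> E \<subseteq> {0..1}" "finite (Z' \<union> E)"
        using Z01 Z'(1) by (auto simp: E_def)
      ultimately show ?case by blast
    qed
    define d where "d = degree Q"
    obtain Z where Z: "\<forall>z\<in>Z. poly ((pderiv ^^ d) Q) z = 0"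
       "card Z + card {a\<in>A. a < Suc d} \<ge> 1 + card {j\<in>J. j < Suc d}"
      using zeros by blast
    then have "card Z \<noteq> 0" using dom[of "Suc d"] by linarith
    then obtain z where z: "poly ((pderiv ^^ d) Q) z = 0" using Z(1) by (metis card.empty ex_in_conv)
    have "degree ((pderiv ^^ d) Q) = 0" by (simp add: degree_higher_pderiv d_def)
    then obtain c where c: "(pderiv ^^ d) Q = [:c:]" using degree_eq_zeroE by blast
    with z have "c = 0" by simp
    with c have "coeff ((pderiv ^^ d) Q) 0 = 0" by simp
    then have "pochhammer 1 d * coeff Q d = 0" by (simp add: coeff_higher_pderiv)
    then have "coeff Q d = 0" by (simp add: pochhammer_fact[symmetric])
    then show False using \<open>Q \<noteq> 0\<close> by (simp add: d_def)
  qed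
  then show ?thesis using coeffQ[of a] \<open>a \<in> A\<close> by simp
qed

lemma two_point_interpolation:
  fixes p :: "nat \<Rightarrow> complex"
  assumes "finite A" "finite J"
    and dom: "\<And>t. card {a\<in>A. a < t} \<le> card {j\<in>J. j < t}"
    and eqs: "\<And>j. j \<in> J \<Longrightarrow> (\<Sum>a\<in>A. of_nat (a choose j) * p a) = 0"
    and "a \<in> A"
  shows "p a = 0"
proof -
  have "Re (p a) = 0"
  proof (rule two_point_interpolation_real[OF assms(1-3) _ \<open>a \<in> A\<close>])
    fix j assume "j \<in> J"
    from arg_cong[OF eqs[OF this], of Re] show "(\<Sum>a\<in>A. of_nat (a choose j) * Re (p a)) = 0"
      by simp
  qed
  moreover have "Im (p a) = 0"
  proof (rule two_point_interpolation_real[OF assms(1-3) _ \<open>a \<in> A\<close>])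
    fix j assume "j \<in> J"
    from arg_cong[OF eqs[OF this], of Im] show "(\<Sum>a\<in>A. of_nat (a choose j) * Im (p a)) = 0"
      by simp
  qed
  ultimately show ?thesis by (simp add: complex_eq_iff)
qed

section \<open>A greedy matching of conditions with exponents\<close>

text \<open>
  Scan the exponents \<open>k \<in> K\<close> upwards and put \<open>k\<close> into \<open>A\<close> whenever some order \<open>j \<le> k\<close> in \<open>J\<close> is not
  yet matched. So every order is matched with an exponent that is not smaller, and as small as
  possible: if \<open>k\<close> is skipped, all orders up to \<open>k\<close> have been matched already. The function \<open>B\<close>
  counts the conditions at the other nodes by order; the last property says that \<open>K - A\<close> still
  has enough large exponents for them.
\<close>

lemma greedy_matching:
  fixes K J :: "nat set" and B :: "nat \<Rightarrow> nat"
  assumes "finite K" "finite J" "antimono B"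
    and le: "\<And>t. card {j\<in>J. t \<le> j} + B t \<le> card {k\<in>K. t \<le> k}"
  obtains A where "A \<subseteq> K" "card A = card J"
    "\<And>t. card {a\<in>A. a < t} \<le> card {j\<in>J. j < t}"
    "\<And>k. k \<in> K - A \<Longrightarrow> card {j\<in>J. j \<le> k} \<le> card {a\<in>A. a < k}"
    "\<And>t. card {a\<in>A. t \<le> a} + B t \<le> card {k\<in>K. t \<le> k}"
proof -
  define sel where "sel = rec_nat {} (\<lambda>t U. if t \<in> K \<and> card U < card {j\<in>J. j \<le> t} then insert t U else U)"
  have sel0: "sel 0 = {}" and selS: "sel (Suc t) =
      (if t \<in> K \<and> card (sel t) < card {j\<in>J. j \<le> t} then insert t (sel t) else sel t)" for t
    by (simp_all add: sel_def)
  define A where "A = {t\<in>K. card (sel t) < card {j\<in>J. j \<le> t}}"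
  have sel: "sel t = {a\<in>A. a < t}" for t
  proof (induction t)
    case (Suc t)
    have "{a\<in>A. a < Suc t} = {a\<in>A. a < t} \<union> (if t \<in> A then {t} else {})"
      by (auto simp: less_Suc_eq)
    moreover have "t \<in> A \<longleftrightarrow> t \<in> K \<and> card (sel t) < card {j\<in>J. j \<le> t}" by (simp add: A_def)
    ultimately show ?case using Suc selS[of t] by simp
  qed (simp add: sel0)
  have A: "k \<in> A \<longleftrightarrow> k \<in> K \<and> card {a\<in>A. a < k} < card {j\<in>J. j \<le> k}" for k
    unfolding sel[symmetric] by (simp add: A_def)
  have sub: "A \<subseteq> K" by (auto simp: A_def)
  then have finA: "finite A" using assms(1) finite_subset by blast
  have AS: "card {a\<in>A. a < Suc t} = card {a\<in>A. a < t} + (if t \<in> A then 1 else 0)" for t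
  proof -
    have "{a\<in>A. a < Suc t} = {a\<in>A. a < t} \<union> (if t \<in> A then {t} else {})" by (auto simp: less_Suc_eq)
    then show ?thesis using finA by auto
  qed
  have dom: "card {a\<in>A. a < t} \<le> card {j\<in>J. j < t}" for t
  proof (induction t)
    case (Suc t)
    have "card {j\<in>J. j < t} \<le> card {j\<in>J. j < Suc t}"
      by (rule card_mono) (use assms(2) in auto)
    with Suc AS[of t] A[of t] show ?case by (auto simp: less_Suc_eq_le split: if_splits)
  qed simp
  have out: "card {j\<in>J. j \<le> k} \<le> card {a\<in>A. a < k}" if "k \<in> K - A" for k
    using that A[of k] by auto
  have split: "card X = card {x\<in>X. x < t} + card {x\<in>X. t \<le> x}" if "finite X" for X :: "nat set" and t
  proof -
    have "card ({x\<in>X. x < t} \<union> {x\<in>X. t \<le> x}) = card {x\<in>X. x < t} + card {x\<in>X. t \<le> x}"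
      by (rule card_Un_disjoint) (use that in auto)
    moreover have "{x\<in>X. x < t} \<union> {x\<in>X. t \<le> x} = X" by auto
    ultimately show ?thesis by simp
  qed
  have cle: "card A \<le> card J"
  proof -
    obtain t where t: "\<forall>x\<in>A \<union> J. x < t"
      using finite_nat_set_iff_bounded[of "A \<union> J"] finA assms(2) by auto
    then have "{a\<in>A. a < t} = A" "{j\<in>J. j < t} = J" by auto
    with dom[of t] show ?thesis by simp
  qed
  \<comment> \<open>When \<open>k\<close> is skipped, all orders up to \<open>k\<close> are matched already, so later exponents are matched with later orders.\<close>
  have outge: "card {a\<in>A. Suc k \<le> a} \<le> card {j\<in>J. Suc k \<le> j}" if "k \<in> K - A" for k
  proof -
    have "card {a\<in>A. a < Suc k} = card {a\<in>A. a < k}" using AS[of k] that by simp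
    moreover have "{j\<in>J. j < Suc k} = {j\<in>J. j \<le> k}" by auto
    ultimately have "card {j\<in>J. j < Suc k} \<le> card {a\<in>A. a < Suc k}"
      using out[OF that] by simp
    then show ?thesis using cle split[OF finA, of "Suc k"] split[OF assms(2), of "Suc k"] by linarith
  qed
  have rest: "card {a\<in>A. t \<le> a} + B t \<le> card {k\<in>K. t \<le> k}" for t
  proof (induction t)
    case 0
    then show ?case using cle le[of 0] by simp
  next
    case (Suc t)
    have BS: "B (Suc t) \<le> B t" using assms(3) by (simp add: antimono_def)
    have S: "card {x\<in>X. t \<le> x} = card {x\<in>X. Suc t \<le> x} + (if t \<in> X then 1 else 0)"
      if "finite X" for X :: "nat set"
    proof -
      have "{x\<in>X. t \<le> x} = {x\<in>X. Suc t \<le> x} \<union> (if t \<in> X then {t} else {})"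
        using Suc_le_eq le_less by auto
      then show ?thesis using that by auto
    qed
    show ?case
    proof (cases "t \<in> K - A")
      case True
      then show ?thesis using outge[OF True] le[of "Suc t"] by linarith
    next
      case False
      then have "t \<in> A \<longleftrightarrow> t \<in> K" using sub by auto
      then show ?thesis using Suc BS S[OF finA] S[OF assms(1)] by (auto split: if_splits)
    qed
  qed
  have "card J \<le> card A"
  proof (cases "K - A = {}")
    case True
    then have "K = A" using sub by auto
    then show ?thesis using le[of 0] by simp
  next
    case False
    define k where "k = Max (K - A)"
    have k: "k \<in> K - A" unfolding k_def using False assms(1) by (intro Max_in) auto
    have "k' \<in> A" if "k' \<in> K" "Suc k \<le> k'" for k'
      using that Max_ge[of "K - A" k'] assms(1) unfolding k_def by (metis DiffI Suc_n_not_le_n finite_Diff le_trans)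
    then have "{k'\<in>K. Suc k \<le> k'} = {a\<in>A. Suc k \<le> a}" using sub by auto
    then have ge: "card {j\<in>J. Suc k \<le> j} \<le> card {a\<in>A. Suc k \<le> a}" using le[of "Suc k"] by simp
    have "{j\<in>J. j < Suc k} = {j\<in>J. j \<le> k}" by auto
    then have "card {j\<in>J. j < Suc k} \<le> card {a\<in>A. a < Suc k}" using out[OF k] AS[of k] by simp
    with ge show ?thesis using split[OF finA, of "Suc k"] split[OF assms(2), of "Suc k"] by linarith
  qed
  with cle have "card A = card J" by simp
  then show ?thesis using that[OF sub _ dom out rest] by blast
qed

section \<open>Unisolvent nodes for a given set of conditions\<close>

text \<open>
  The derivative of \<open>x\<^sup>k\<close> of order \<open>snd c\<close> at the node \<open>x (fst c)\<close>, divided by the factorial of the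
  order. This keeps the entry a binomial coefficient times a power.
\<close>

definition birkhoff_entry :: "(nat \<Rightarrow> complex) \<Rightarrow> nat \<times> nat \<Rightarrow> nat \<Rightarrow> complex" where
  "birkhoff_entry x c k = of_nat (k choose snd c) * x (fst c) ^ (k - snd c)"

text \<open>
  The exponents form an arbitrary set \<open>K\<close>, not just an initial segment, because adding a node
  removes exponents from anywhere in \<open>K\<close>.
\<close>

definition unisolvent :: "(nat \<Rightarrow> complex) \<Rightarrow> (nat \<times> nat) set \<Rightarrow> nat set \<Rightarrow> bool" where
  "unisolvent x S K \<longleftrightarrow>
     (\<forall>p. (\<forall>c\<in>S. (\<Sum>k\<in>K. birkhoff_entry x c k * p k) = 0) \<longrightarrow> (\<forall>k\<in>K. p k = 0))"

text \<open>
  The coordinates \<open>j > k\<close> vanish for all exponents up to \<open>k\<close>, so the vectors of \<open>k\<close> and of the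
  exponents \<open>a < k\<close> in \<open>A\<close> have at most as many nontrivial coordinates as there are such \<open>a\<close>. Hence
  they are linearly dependent, and by two-point interpolation the relation must involve \<open>k\<close>.
\<close>

lemma binomial_vector_in_span:
  fixes A J :: "nat set"
  assumes "finite A" "finite J" "k \<notin> A"
    and dom: "\<And>t. card {a\<in>A. a < t} \<le> card {j\<in>J. j < t}"
    and out: "card {j\<in>J. j \<le> k} \<le> card {a\<in>A. a < k}"
  shows "\<exists>g :: nat \<Rightarrow> complex. (\<forall>a. g a \<noteq> 0 \<longrightarrow> a < k) \<and>
    (\<forall>j\<in>J. (\<Sum>a\<in>A. of_nat (a choose j) * g a) = of_nat (k choose j))"
proof -
  define U where "U = {a\<in>A. a < k}"
  have U: "finite U" "k \<notin> U" "U \<subseteq> A" using assms(1) by (auto simp: U_def)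
  have "card {j\<in>J. j \<le> k} < card (insert k U)" using out U by (simp add: U_def)
  moreover have "finite {j\<in>J. j \<le> k}" "finite (insert k U)" using assms(2) U(1) by auto
  ultimately have "\<exists>p. (\<exists>a\<in>insert k U. p a \<noteq> 0) \<and>
      (\<forall>j\<in>{j\<in>J. j \<le> k}. (\<Sum>a\<in>insert k U. complex_of_nat (a choose j) * p a) = 0)"
    by (intro underdetermined_system_has_solution)
  then obtain p k0 where k0: "k0 \<in> insert k U" "p k0 \<noteq> 0"
    and p: "\<forall>j\<in>{j\<in>J. j \<le> k}. (\<Sum>a\<in>insert k U. complex_of_nat (a choose j) * p a) = 0"
    by blast
  have eq: "of_nat (k choose j) * p k + (\<Sum>a\<in>U. complex_of_nat (a choose j) * p a) = 0" if "j \<in> J" for j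
  proof (cases "j \<le> k")
    case True
    with that p U show ?thesis by simp
  next
    case False
    then have "(\<Sum>a\<in>U. complex_of_nat (a choose j) * p a) = 0"
      by (intro sum.neutral) (auto simp: U_def binomial_eq_0)
    with False show ?thesis by (simp add: binomial_eq_0)
  qed
  have restrict: "(\<Sum>a\<in>A. complex_of_nat (a choose j) * (if a \<in> U then q a else 0)) =
      (\<Sum>a\<in>U. complex_of_nat (a choose j) * q a)" for q j
    by (rule sum.mono_neutral_cong_right) (use U assms(1) in auto)
  have "p k \<noteq> 0"
  proof
    assume pk: "p k = 0"
    have "(if a \<in> U then p a else 0) = 0" if "a \<in> A" for a
      by (rule two_point_interpolation[OF assms(1,2) dom _ that])
         (use eq pk in \<open>simp_all add: restrict\<close>)
    then show False using k0 pk U(3) by (metis insertE subsetD)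
  qed
  show ?thesis
  proof (intro exI[of _ "\<lambda>a. if a \<in> U then - p a / p k else 0"] conjI ballI)
    fix j assume j: "j \<in> J"
    have "(\<Sum>a\<in>U. complex_of_nat (a choose j) * (- p a / p k)) =
        - (\<Sum>a\<in>U. complex_of_nat (a choose j) * p a) / p k"
      by (simp add: sum_negf sum_divide_distrib)
    also have "\<dots> = of_nat (k choose j)"
      using eq[OF j] \<open>p k \<noteq> 0\<close> by (simp add: add_eq_0_iff2 field_simps)
    finally show "(\<Sum>a\<in>A. complex_of_nat (a choose j) * (if a \<in> U then - p a / p k else 0)) =
        of_nat (k choose j)" by (simp add: restrict)
  qed (auto simp: U_def split: if_splits)
qed

text \<open>
  At the new node \<open>\<epsilon>\<close>, the conditions \<open>J\<close> express the coefficients with exponents in \<open>A\<close> through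
  those with exponents in \<open>K - A\<close>. The one with exponent \<open>k\<close> contributes only to exponents \<open>a < k\<close>,
  and with the factor \<open>\<epsilon>\<^sup>k\<^sup>-\<^sup>a\<close>. As \<open>\<epsilon> \<rightarrow> 0\<close> the determinant of the conditions \<open>S\<close>,
  restricted to the solutions of the new conditions, therefore tends to the determinant for the
  exponents \<open>K - A\<close>, which is not zero.
\<close>

lemma unisolvent_add_node:
  fixes K A J :: "nat set"
  assumes "finite K" "finite J" "A \<subseteq> K" "finite S" "S \<subseteq> {..<m} \<times> UNIV"
    and "card S = card (K - A)" and uni: "unisolvent x S (K - A)"
    and dom: "\<And>t. card {a\<in>A. a < t} \<le> card {j\<in>J. j < t}"
    and out: "\<And>k. k \<in> K - A \<Longrightarrow> card {j\<in>J. j \<le> k} \<le> card {a\<in>A. a < k}"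
  shows "\<exists>\<epsilon>. unisolvent (x(m := \<epsilon>)) (S \<union> {m} \<times> J) K"
proof -
  define K' where "K' = K - A"
  have fin: "finite A" "finite K'" using assms(1,3) finite_subset by (auto simp: K'_def)
  have "\<exists>g :: nat \<Rightarrow> complex. (\<forall>a. g a \<noteq> 0 \<longrightarrow> a < k) \<and>
      (\<forall>j\<in>J. (\<Sum>a\<in>A. of_nat (a choose j) * g a) = of_nat (k choose j))" if "k \<in> K'" for k
    using that by (intro binomial_vector_in_span[OF fin(1) assms(2) _ dom out]) (auto simp: K'_def)
  then obtain G :: "nat \<Rightarrow> nat \<Rightarrow> complex" where
    G: "\<And>k a. k \<in> K' \<Longrightarrow> G k a \<noteq> 0 \<Longrightarrow> a < k"
    and Gsum: "\<And>k j. k \<in> K' \<Longrightarrow> j \<in> J \<Longrightarrow> (\<Sum>a\<in>A. of_nat (a choose j) * G k a) = of_nat (k choose j)"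
    by metis
  \<comment> \<open>The conditions \<open>S\<close> in the basis \<open>x\<^sup>k - (\<Sum>a\<in>A. G k a \<epsilon>\<^sup>k\<^sup>-\<^sup>a x\<^sup>a)\<close>, \<open>k \<in> K'\<close>, of the polynomials that satisfy the conditions at \<open>\<epsilon>\<close>.\<close>
  define w where "w = (\<lambda>\<epsilon> c k. birkhoff_entry x c k -
     (\<Sum>a\<in>A. G k a * \<epsilon> ^ (k - a) * birkhoff_entry x c a))"
  obtain \<Phi> s where fin\<Phi>: "finite \<Phi>" and det: "\<And>w :: nat \<times> nat \<Rightarrow> nat \<Rightarrow> complex.
      (\<Sum>\<phi>\<in>\<Phi>. of_int (s \<phi>) * (\<Prod>c\<in>S. w c (\<phi> c))) = 0 \<longleftrightarrow>
      (\<exists>p. (\<exists>k\<in>K'. p k \<noteq> 0) \<and> (\<forall>c\<in>S. (\<Sum>k\<in>K'. w c k * p k) = 0))"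
    using kernel_det_expansion[OF assms(4) fin(2) assms(6)[folded K'_def]] by blast
  define D where "D = (\<lambda>\<epsilon>. \<Sum>\<phi>\<in>\<Phi>. of_int (s \<phi>) * (\<Prod>c\<in>S. w \<epsilon> c (\<phi> c)))"
  have "(\<Sum>k\<in>K'. w 0 c k * p k) = (\<Sum>k\<in>K'. birkhoff_entry x c k * p k)" for c p
  proof (rule sum.cong[OF refl])
    fix k assume k: "k \<in> K'"
    have "G k a * 0 ^ (k - a) = 0" for a
      using G[OF k, of a] by (cases "G k a = 0") (simp_all add: power_0_left)
    then have "(\<Sum>a\<in>A. G k a * 0 ^ (k - a) * birkhoff_entry x c a) = 0"
      by (simp only: mult_zero_left sum.neutral_const)
    then show "w 0 c k * p k = birkhoff_entry x c k * p k" by (simp add: w_def)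
  qed
  then have D0: "D 0 \<noteq> 0"
    using uni unfolding D_def det unisolvent_def K'_def by auto
  have "isCont D 0"
    unfolding D_def w_def by (intro continuous_intros)
  moreover have "(\<lambda>n. complex_of_real (inverse (real (Suc n)))) \<longlonglongrightarrow> 0"
    using tendsto_of_real[OF LIMSEQ_inverse_real_of_nat, where 'a = complex]
    by (simp only: of_real_0)
  ultimately have "(\<lambda>n. D (complex_of_real (inverse (real (Suc n))))) \<longlonglongrightarrow> D 0"
    by (rule isCont_tendsto_compose)
  then have "\<forall>\<^sub>F n in sequentially. D (complex_of_real (inverse (real (Suc n)))) \<noteq> 0"
    using D0 tendsto_imp_eventually_ne by blast
  then obtain n where n: "D (complex_of_real (inverse (real (Suc n)))) \<noteq> 0"
    unfolding eventually_sequentially by blast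
  define \<epsilon> where "\<epsilon> = complex_of_real (inverse (real (Suc n)))"
  have \<epsilon>: "\<epsilon> \<noteq> 0" "D \<epsilon> \<noteq> 0"
    using n unfolding \<epsilon>_def of_real_eq_0_iff by simp_all
  have "unisolvent (x(m := \<epsilon>)) (S \<union> {m} \<times> J) K"
    unfolding unisolvent_def
  proof (intro allI impI)
    fix p assume p: "\<forall>c\<in>S \<union> {m} \<times> J. (\<Sum>k\<in>K. birkhoff_entry (x(m := \<epsilon>)) c k * p k) = 0"
    have Ksplit: "(\<Sum>k\<in>K. f k) = (\<Sum>k\<in>K'. f k) + (\<Sum>a\<in>A. f a)" for f :: "nat \<Rightarrow> complex"
      using sum.subset_diff[OF assms(3,1), of f] by (simp add: K'_def)
    \<comment> \<open>After multiplication by \<open>\<epsilon>\<^sup>j\<close>, the conditions at \<open>\<epsilon>\<close> are two-point conditions on \<open>h\<close>.\<close>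
    define h where "h = (\<lambda>a. p a * \<epsilon> ^ a + (\<Sum>k\<in>K'. G k a * (p k * \<epsilon> ^ k)))"
    have h0: "h a = 0" if "a \<in> A" for a
    proof (rule two_point_interpolation[OF fin(1) assms(2) dom _ that])
      fix j assume j: "j \<in> J"
      have "0 = \<epsilon> ^ j * (\<Sum>k\<in>K. birkhoff_entry (x(m := \<epsilon>)) (m, j) k * p k)"
        using p j by simp
      also have "\<dots> = (\<Sum>k\<in>K. of_nat (k choose j) * (p k * \<epsilon> ^ k))"
        unfolding sum_distrib_left
      proof (rule sum.cong[OF refl])
        fix k
        show "\<epsilon> ^ j * (birkhoff_entry (x(m := \<epsilon>)) (m, j) k * p k) = of_nat (k choose j) * (p k * \<epsilon> ^ k)"
        proof (cases "j \<le> k")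
          case True
          then have "\<epsilon> ^ k = \<epsilon> ^ j * \<epsilon> ^ (k - j)" by (simp flip: power_add)
          then show ?thesis by (simp add: birkhoff_entry_def)
        qed (simp add: birkhoff_entry_def)
      qed
      also have "\<dots> = (\<Sum>k\<in>K'. of_nat (k choose j) * (p k * \<epsilon> ^ k)) +
          (\<Sum>a\<in>A. of_nat (a choose j) * (p a * \<epsilon> ^ a))"
        by (rule Ksplit)
      also have "(\<Sum>k\<in>K'. of_nat (k choose j) * (p k * \<epsilon> ^ k)) =
          (\<Sum>k\<in>K'. \<Sum>a\<in>A. of_nat (a choose j) * (G k a * (p k * \<epsilon> ^ k)))"
      proof (rule sum.cong[OF refl])
        fix k assume "k \<in> K'"
        then have "of_nat (k choose j) * (p k * \<epsilon> ^ k) =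
           (\<Sum>a\<in>A. of_nat (a choose j) * G k a) * (p k * \<epsilon> ^ k)" by (simp only: Gsum j)
        then show "of_nat (k choose j) * (p k * \<epsilon> ^ k) =
           (\<Sum>a\<in>A. of_nat (a choose j) * (G k a * (p k * \<epsilon> ^ k)))"
          by (simp add: sum_distrib_right mult.assoc)
      qed
      also have "\<dots> = (\<Sum>a\<in>A. \<Sum>k\<in>K'. of_nat (a choose j) * (G k a * (p k * \<epsilon> ^ k)))"
        by (rule sum.swap)
      finally show "(\<Sum>a\<in>A. of_nat (a choose j) * h a) = 0"
        by (simp add: h_def distrib_left sum.distrib sum_distrib_left add.commute)
    qed
    have pA: "p a = - (\<Sum>k\<in>K'. G k a * \<epsilon> ^ (k - a) * p k)" if "a \<in> A" for a
    proof -
      have "G k a * (p k * \<epsilon> ^ k) = \<epsilon> ^ a * (G k a * \<epsilon> ^ (k - a) * p k)" if "k \<in> K'" for k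
      proof (cases "G k a = 0")
        case False
        then have "a < k" using G[OF that] by blast
        then have "\<epsilon> ^ k = \<epsilon> ^ a * \<epsilon> ^ (k - a)" using power_add[of \<epsilon> a "k - a"] by simp
        then show ?thesis by simp
      qed simp
      then have "(\<Sum>k\<in>K'. G k a * (p k * \<epsilon> ^ k)) = \<epsilon> ^ a * (\<Sum>k\<in>K'. G k a * \<epsilon> ^ (k - a) * p k)"
        unfolding sum_distrib_left by (rule sum.cong[OF refl])
      then have "h a = \<epsilon> ^ a * (p a + (\<Sum>k\<in>K'. G k a * \<epsilon> ^ (k - a) * p k))"
        by (simp add: h_def distrib_left mult.commute)
      then show ?thesis using h0[OF that] \<epsilon>(1) by (simp add: add_eq_0_iff)
    qed
    have "(\<Sum>k\<in>K'. w \<epsilon> c k * p k) = 0" if c: "c \<in> S" for c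
    proof -
      have "fst c \<noteq> m" using c assms(5) by auto
      then have be: "birkhoff_entry (x(m := \<epsilon>)) c = birkhoff_entry x c"
        by (auto simp: birkhoff_entry_def)
      have "0 = (\<Sum>k\<in>K. birkhoff_entry x c k * p k)" using bspec[OF p, of c] c be by simp
      also have "\<dots> = (\<Sum>k\<in>K'. birkhoff_entry x c k * p k) + (\<Sum>a\<in>A. birkhoff_entry x c a * p a)"
        by (rule Ksplit)
      also have "(\<Sum>a\<in>A. birkhoff_entry x c a * p a) =
          (\<Sum>a\<in>A. \<Sum>k\<in>K'. - (G k a * \<epsilon> ^ (k - a) * birkhoff_entry x c a * p k))"
        by (rule sum.cong[OF refl]) (subst pA; simp add: sum_distrib_left sum_negf mult_ac)
      also have "\<dots> = (\<Sum>k\<in>K'. \<Sum>a\<in>A. - (G k a * \<epsilon> ^ (k - a) * birkhoff_entry x c a * p k))"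
        by (rule sum.swap)
      finally show ?thesis
        by (simp add: w_def left_diff_distrib sum_subtractf sum_distrib_right sum_negf)
    qed
    then have K0: "p k = 0" if "k \<in> K'" for k
      using \<epsilon>(2) that unfolding D_def det by blast
    moreover have "p a = 0" if "a \<in> A" for a
      using pA[OF that] K0 by simp
    ultimately show "\<forall>k\<in>K. p k = 0" by (auto simp: K'_def)
  qed
  then show ?thesis by blast
qed

text \<open>
  Induction on the number of nodes: the last node takes the exponents that the greedy matching
  assigns to its orders, and the others are placed for the remaining exponents. That the counting
  condition passes on to them is the last property of the matching.
\<close>

lemma exists_unisolvent_nodes:
  assumes "finite K" "finite S" "S \<subseteq> {..<m} \<times> UNIV" "card S = card K"
    and "\<And>t. card {c\<in>S. t \<le> snd c} \<le> card {k\<in>K. t \<le> k}"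
  shows "\<exists>x. unisolvent x S K"
  using assms
proof (induction m arbitrary: S K)
  case 0
  then have "K = {}" by simp
  then show ?case by (simp add: unisolvent_def)
next
  case (Suc m)
  define J where "J = {j. (m, j) \<in> S}"
  define S' where "S' = {c\<in>S. fst c < m}"
  have S: "S = S' \<union> {m} \<times> J"
    using Suc.prems(3) by (auto simp: J_def S'_def less_Suc_eq)
  have "J = snd ` (S \<inter> {m} \<times> UNIV)" by (force simp: J_def)
  then have fin: "finite J" "finite S'" using Suc.prems(2) by (simp_all add: S'_def)
  define B where "B t = card {c\<in>S'. t \<le> snd c}" for t
  have split: "card {c\<in>S. t \<le> snd c} = card {j\<in>J. t \<le> j} + B t" for t
  proof -
    have "{c\<in>S. t \<le> snd c} = {m} \<times> {j\<in>J. t \<le> j} \<union> {c\<in>S'. t \<le> snd c}"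
      by (subst S) auto
    moreover have "card ({m} \<times> {j\<in>J. t \<le> j} \<union> {c\<in>S'. t \<le> snd c}) =
        card ({m} \<times> {j\<in>J. t \<le> j}) + card {c\<in>S'. t \<le> snd c}"
      by (rule card_Un_disjoint) (use fin(1) Suc.prems(2) in \<open>auto simp: S'_def\<close>)
    ultimately show ?thesis by (simp add: B_def card_cartesian_product)
  qed
  have "B t \<le> B s" if "s \<le> t" for s t
    unfolding B_def by (rule card_mono) (use that fin(2) in auto)
  then have anti: "antimono B" by (simp add: antimono_def)
  have "card {j\<in>J. t \<le> j} + B t \<le> card {k\<in>K. t \<le> k}" for t
    using Suc.prems(5)[of t] split[of t] by simp
  then obtain A where A: "A \<subseteq> K" "card A = card J"
    "\<And>t. card {a\<in>A. a < t} \<le> card {j\<in>J. j < t}"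
    "\<And>k. k \<in> K - A \<Longrightarrow> card {j\<in>J. j \<le> k} \<le> card {a\<in>A. a < k}"
    "\<And>t. card {a\<in>A. t \<le> a} + B t \<le> card {k\<in>K. t \<le> k}"
    by (rule greedy_matching[OF Suc.prems(1) fin(1) anti]) (rule that)
  have finA: "finite A" using A(1) Suc.prems(1) finite_subset by blast
  have cS': "card S' = card (K - A)"
    using split[of 0] Suc.prems(4) A(2) finA A(1) by (simp add: card_Diff_subset B_def)
  have dom': "card {c\<in>S'. t \<le> snd c} \<le> card {k\<in>K - A. t \<le> k}" for t
  proof -
    have "{k\<in>K - A. t \<le> k} = {k\<in>K. t \<le> k} - {a\<in>A. t \<le> a}" by auto
    moreover have "card ({k\<in>K. t \<le> k} - {a\<in>A. t \<le> a}) = card {k\<in>K. t \<le> k} - card {a\<in>A. t \<le> a}"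
      by (rule card_Diff_subset) (use finA A(1) in auto)
    ultimately show ?thesis using A(5)[of t] by (simp add: B_def)
  qed
  have S'm: "S' \<subseteq> {..<m} \<times> UNIV" by (auto simp: S'_def)
  have "\<exists>x. unisolvent x S' (K - A)"
    by (rule Suc.IH[OF finite_Diff[OF Suc.prems(1)] fin(2) S'm cS' dom'])
  then obtain x where x: "unisolvent x S' (K - A)" by blast
  have "\<exists>\<epsilon>. unisolvent (x(m := \<epsilon>)) (S' \<union> {m} \<times> J) K"
    by (rule unisolvent_add_node[OF Suc.prems(1) fin(1) A(1) fin(2) S'm cS' x A(3,4)])
  then show ?case unfolding S[symmetric] by blast
qed

section \<open>Unisolvence at affinely algebraically independent nodes\<close>

lemma eval_mpoly_superset:
  assumes "finite W" "Poly_Mapping.keys R \<subseteq> W"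
  shows "eval_mpoly R x = (\<Sum>u\<in>W. of_rat (Poly_Mapping.lookup R u) *
    (\<Prod>i\<in>Poly_Mapping.keys u. x i ^ Poly_Mapping.lookup u i))"
  unfolding eval_mpoly_def using assms
  by (intro sum.mono_neutral_left) (auto simp: in_keys_iff)

lemma eval_mpoly_add: "eval_mpoly (R + R') x = eval_mpoly R x + eval_mpoly R' x"
proof -
  define W where "W = Poly_Mapping.keys R \<union> Poly_Mapping.keys R'"
  have "finite W" by (simp add: W_def)
  moreover have "Poly_Mapping.keys (R + R') \<subseteq> W" "Poly_Mapping.keys R \<subseteq> W" "Poly_Mapping.keys R' \<subseteq> W"
    using keys_add[of R R'] by (auto simp: W_def)
  ultimately show ?thesis
    by (simp add: eval_mpoly_superset[of W] lookup_add of_rat_add distrib_right sum.distrib)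
qed

text \<open>
  Terms with different indices may share a monomial, so the polynomial is built by adding one term
  at a time.
\<close>

lemma exists_mpoly_of_monomial_sum:
  fixes q :: "'a \<Rightarrow> rat" and e :: "'a \<Rightarrow> nat \<Rightarrow> nat"
  assumes "finite \<Phi>"
  shows "\<exists>R\<in>mpolys_in m. \<forall>x. eval_mpoly R x = (\<Sum>\<phi>\<in>\<Phi>. of_rat (q \<phi>) * (\<Prod>i<m. x i ^ e \<phi> i))"
  using assms
proof (induction \<Phi>)
  case empty
  show ?case by (intro bexI[of _ 0]) (simp_all add: eval_mpoly_def mpolys_in_def)
next
  case (insert \<phi> \<Phi>)
  then obtain R where R: "R \<in> mpolys_in m"
    "\<And>x. eval_mpoly R x = (\<Sum>\<phi>\<in>\<Phi>. of_rat (q \<phi>) * (\<Prod>i<m. x i ^ e \<phi> i))" by blast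
  define v where "v = (\<lambda>i. if i < m then e \<phi> i else 0)"
  have "finite {i. v i \<noteq> 0}"
    by (rule finite_subset[of _ "{..<m}"]) (auto simp: v_def split: if_splits)
  then have lv: "Poly_Mapping.lookup (Abs_poly_mapping v) = v" by simp
  define u where "u = Abs_poly_mapping v"
  have ku: "Poly_Mapping.keys u \<subseteq> {..<m}"
    by (auto simp: in_keys_iff u_def lv) (auto simp: v_def split: if_splits)
  have "(\<Prod>i\<in>Poly_Mapping.keys u. x i ^ Poly_Mapping.lookup u i) = (\<Prod>i<m. x i ^ e \<phi> i)"
    for x :: "nat \<Rightarrow> complex"
    using ku by (intro prod.mono_neutral_cong_left) (auto simp: in_keys_iff u_def lv v_def)
  then have single: "eval_mpoly (Poly_Mapping.single u (q \<phi>)) x = of_rat (q \<phi>) * (\<Prod>i<m. x i ^ e \<phi> i)" for x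
    by (subst eval_mpoly_superset[of "{u}"]) auto
  have "Poly_Mapping.single u (q \<phi>) + R \<in> mpolys_in m"
    using R(1) ku keys_add[of "Poly_Mapping.single u (q \<phi>)" R]
    by (auto simp: mpolys_in_def split: if_splits)
  then show ?case
    using insert.hyps by (intro bexI) (auto simp: eval_mpoly_add single R(2))
qed

lemma continuous_eval_mpoly:
  assumes "\<And>i. isCont (\<lambda>b. f b i) b0"
  shows "isCont (\<lambda>b. eval_mpoly R (f b)) b0"
  unfolding eval_mpoly_def using assms by (intro continuous_intros)

lemma unisolvent_iff_poly:
  "unisolvent x S {..<N} \<longleftrightarrow>
     (\<forall>P. (P = 0 \<or> degree P < N) \<longrightarrow> (\<forall>c\<in>S. poly ((pderiv ^^ snd c) P) (x (fst c)) = 0) \<longrightarrow> P = 0)"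
proof -
  have eval: "poly ((pderiv ^^ snd c) P) (x (fst c)) = fact (snd c) * (\<Sum>k<N. birkhoff_entry x c k * coeff P k)"
    if "P = 0 \<or> degree P < N" for P c
    using that
  proof
    assume "degree P < N"
    then show ?thesis by (simp add: poly_higher_pderiv birkhoff_entry_def)
  qed simp
  show ?thesis
  proof
    assume uni: "unisolvent x S {..<N}"
    show "\<forall>P. (P = 0 \<or> degree P < N) \<longrightarrow> (\<forall>c\<in>S. poly ((pderiv ^^ snd c) P) (x (fst c)) = 0) \<longrightarrow> P = 0"
    proof (intro allI impI)
      fix P assume P: "P = 0 \<or> degree P < N" "\<forall>c\<in>S. poly ((pderiv ^^ snd c) P) (x (fst c)) = 0"
      then have "\<forall>k<N. coeff P k = 0"
        using uni unfolding unisolvent_def by (simp add: eval)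
      then show "P = 0" using P(1) by (metis leading_coeff_0_iff)
    qed
  next
    assume *: "\<forall>P. (P = 0 \<or> degree P < N) \<longrightarrow> (\<forall>c\<in>S. poly ((pderiv ^^ snd c) P) (x (fst c)) = 0) \<longrightarrow> P = 0"
    show "unisolvent x S {..<N}"
      unfolding unisolvent_def
    proof (intro allI impI)
      fix p assume p: "\<forall>c\<in>S. (\<Sum>k<N. birkhoff_entry x c k * p k) = 0"
      define P where "P = (\<Sum>k<N. monom (p k) k)"
      have co: "coeff P k = (if k < N then p k else 0)" for k
        by (simp add: P_def coeff_sum if_distrib cong: if_cong)
      have deg: "P = 0 \<or> degree P < N" using co[of "degree P"] by (metis leading_coeff_0_iff)
      have "\<forall>c\<in>S. poly ((pderiv ^^ snd c) P) (x (fst c)) = 0" using p by (simp add: eval[OF deg] co)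
      then have "P = 0" using * deg by blast
      then show "\<forall>k\<in>{..<N}. p k = 0" using co by (metis coeff_0 lessThan_iff)
    qed
  qed
qed

lemma higher_pderiv_pcompose_linear:
  fixes P :: "'a::idom poly"
  shows "(pderiv ^^ j) (pcompose P [:a, b:]) = Polynomial.smult (b ^ j) (pcompose ((pderiv ^^ j) P) [:a, b:])"
proof (induction j)
  case (Suc j)
  have "pderiv [:a, b:] = [:b:]" by (simp add: pderiv_pCons)
  then show ?case using Suc by (simp add: pderiv_smult pderiv_pcompose mult.commute)
qed simp

text \<open>
  The affine map that carries the nodes \<open>a + b x\<^sub>i\<close> back to \<open>x\<^sub>i\<close> acts on polynomials by composition
  and preserves degrees and zeros of derivatives.
\<close>

lemma unisolvent_affine:
  assumes "unisolvent (\<lambda>i. a + b * x i) S {..<N}" "b \<noteq> 0"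
  shows "unisolvent x S {..<N}"
  unfolding unisolvent_iff_poly
proof (intro allI impI)
  fix P assume P: "P = 0 \<or> degree P < N" "\<forall>c\<in>S. poly ((pderiv ^^ snd c) P) (x (fst c)) = 0"
  define L where "L = [: - a / b, 1 / b:]"
  have dL: "degree L = 1" using assms(2) by (simp add: L_def)
  have "poly L (a + b * y) = y" for y using assms(2) by (simp add: L_def field_simps)
  then have "\<forall>c\<in>S. poly ((pderiv ^^ snd c) (pcompose P L)) (a + b * x (fst c)) = 0"
    using P(2) by (simp add: L_def higher_pderiv_pcompose_linear poly_pcompose)
  moreover have "pcompose P L = 0 \<or> degree (pcompose P L) < N"
    using P(1) dL by (auto simp: degree_pcompose)
  ultimately have "pcompose P L = 0" using assms(1) unfolding unisolvent_iff_poly by blast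
  then show "P = 0" using dL pcompose_eq_0[of P L] by simp
qed

text \<open>
  The determinant of the conditions is a polynomial \<open>R\<close> in the nodes with rational coefficients. If
  it vanishes at \<open>\<Lambda>\<close>, then by affine invariance also at all \<open>a + b \<Lambda>\<close>, so \<open>R\<close> is a dependence and
  \<open>R = 0\<close>. This contradicts the existence of some unisolvent tuple of nodes.
\<close>

theorem affine_alg_independent_unisolvent:
  assumes indep: "affine_alg_independent \<Lambda>"
    and S: "S \<subseteq> {..<length \<Lambda>} \<times> UNIV" "finite S" "card S = N"
    and pol: "\<And>t. card {c\<in>S. t \<le> snd c} \<le> N - t"
  shows "unisolvent (\<lambda>i. \<Lambda> ! i) S {..<N}"
proof (rule ccontr)
  define m where "m = length \<Lambda>"
  assume sing: "\<not> unisolvent (\<lambda>i. \<Lambda> ! i) S {..<N}"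
  have cN: "card S = card {..<N}" using S(3) by simp
  obtain \<Phi> s where fin\<Phi>: "finite \<Phi>" and det: "\<And>w :: nat \<times> nat \<Rightarrow> nat \<Rightarrow> complex.
      (\<Sum>\<phi>\<in>\<Phi>. of_int (s \<phi>) * (\<Prod>c\<in>S. w c (\<phi> c))) = 0 \<longleftrightarrow>
      (\<exists>p. (\<exists>k\<in>{..<N}. p k \<noteq> 0) \<and> (\<forall>c\<in>S. (\<Sum>k\<in>{..<N}. w c k * p k) = 0))"
    using kernel_det_expansion[OF S(2) finite_lessThan cN] by blast
  define q where "q \<phi> = of_int (s \<phi>) * (\<Prod>c\<in>S. of_nat (\<phi> c choose snd c) :: rat)" for \<phi>
  define e where "e \<phi> i = (\<Sum>c\<in>{c\<in>S. fst c = i}. \<phi> c - snd c)" for \<phi> :: "nat \<times> nat \<Rightarrow> nat" and i :: nat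
  obtain R where R: "R \<in> mpolys_in m"
    and evR: "\<And>x. eval_mpoly R x = (\<Sum>\<phi>\<in>\<Phi>. of_rat (q \<phi>) * (\<Prod>i<m. x i ^ e \<phi> i))"
    using exists_mpoly_of_monomial_sum[OF fin\<Phi>, of m q e] by blast
  have "eval_mpoly R x = (\<Sum>\<phi>\<in>\<Phi>. of_int (s \<phi>) * (\<Prod>c\<in>S. birkhoff_entry x c (\<phi> c)))" for x
    unfolding evR
  proof (rule sum.cong[OF refl])
    fix \<phi>
    have "(\<Prod>c\<in>S. x (fst c) ^ (\<phi> c - snd c)) =
        (\<Prod>i<m. \<Prod>c\<in>{c\<in>S. fst c = i}. x (fst c) ^ (\<phi> c - snd c))"
      by (rule prod.group[symmetric]) (use S m_def in auto)
    also have "\<dots> = (\<Prod>i<m. x i ^ e \<phi> i)"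
      unfolding e_def power_sum by (intro prod.cong) auto
    finally show "of_rat (q \<phi>) * (\<Prod>i<m. x i ^ e \<phi> i) =
        of_int (s \<phi>) * (\<Prod>c\<in>S. birkhoff_entry x c (\<phi> c))"
      by (simp add: q_def birkhoff_entry_def prod.distrib of_rat_mult of_rat_prod)
  qed
  then have zero: "eval_mpoly R x = 0 \<longleftrightarrow> \<not> unisolvent x S {..<N}" for x
    using det[of "birkhoff_entry x"] by (auto simp: unisolvent_def)
  \<comment> \<open>Nodes with \<open>b = 0\<close> all coincide and are reached by continuity in \<open>b\<close>.\<close>
  have nz: "eval_mpoly R (\<lambda>i. a + b * \<Lambda> ! i) = 0" if "b \<noteq> 0" for a b
    using unisolvent_affine[OF _ that] sing zero by blast
  have "eval_mpoly R (\<lambda>i. a + b * \<Lambda> ! i) = 0" for a b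
  proof (cases "b = 0")
    case True
    have "isCont (\<lambda>b. eval_mpoly R (\<lambda>i. a + b * \<Lambda> ! i)) 0"
      by (intro continuous_eval_mpoly continuous_intros)
    then have "((\<lambda>b. eval_mpoly R (\<lambda>i. a + b * \<Lambda> ! i)) \<longlongrightarrow> eval_mpoly R (\<lambda>i. a + 0 * \<Lambda> ! i)) (at 0)"
      by (simp add: isCont_def)
    moreover have "((\<lambda>b. eval_mpoly R (\<lambda>i. a + b * \<Lambda> ! i)) \<longlongrightarrow> 0) (at 0)"
      by (rule tendsto_eventually) (auto simp: eventually_at_filter nz)
    ultimately have "eval_mpoly R (\<lambda>i. a + 0 * \<Lambda> ! i) = 0" by (rule LIM_unique)
    then show ?thesis using True by simp
  qed (rule nz)
  then have "affine_alg_dependence \<Lambda> R"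
    using R by (simp add: affine_alg_dependence_def m_def)
  then have "R = 0" using indep by (simp add: affine_alg_independent_def)
  have "card {k\<in>{..<N}. t \<le> k} = N - t" for t
  proof -
    have "{k\<in>{..<N}. t \<le> k} = {t..<N}" by auto
    then show ?thesis by simp
  qed
  then have dom: "card {c\<in>S. t \<le> snd c} \<le> card {k\<in>{..<N}. t \<le> k}" for t using pol[of t] by simp
  obtain x where "unisolvent x S {..<N}"
    using exists_unisolvent_nodes[OF finite_lessThan S(2,1) cN dom] by blast
  then have "eval_mpoly R x \<noteq> 0" by (simp add: zero)
  then show False using \<open>R = 0\<close> by (simp add: eval_mpoly_def)
qed

section \<open>Existence of affinely algebraically independent tuples\<close>

text \<open>
  Algebraic independence over the rationals of \<open>x 0, \<dots>, x (m - 1)\<close>, stated as linear independence of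
  monomials. With exponents as plain functions, the last exponent can be split off by a function
  update.
\<close>

definition monomial_independent :: "nat \<Rightarrow> (nat \<Rightarrow> complex) \<Rightarrow> bool" where
  "monomial_independent m x \<longleftrightarrow>
     (\<forall>U (c :: (nat \<Rightarrow> nat) \<Rightarrow> rat). finite U \<longrightarrow> (\<forall>u\<in>U. \<forall>i\<ge>m. u i = 0) \<longrightarrow>
        (\<Sum>u\<in>U. of_rat (c u) * (\<Prod>i<m. x i ^ u i)) = 0 \<longrightarrow> (\<forall>u\<in>U. c u = 0))"

lemma countable_polys_over:
  assumes "countable E"
  shows "countable {p :: 'a::zero poly. \<forall>i. coeff p i \<in> E}"
proof (rule countable_subset)
  show "countable (Poly ` lists E)" using assms by simp
  show "{p. \<forall>i. coeff p i \<in> E} \<subseteq> Poly ` lists E"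
  proof
    fix p :: "'a poly" assume p: "p \<in> {p. \<forall>i. coeff p i \<in> E}"
    have "set (coeffs p) \<subseteq> range (coeff p)" by (auto simp: coeffs_def)
    with p have "coeffs p \<in> lists E" by (auto simp: lists_eq_set)
    then show "p \<in> Poly ` lists E" by (intro image_eqI[of _ _ "coeffs p"]) simp_all
  qed
qed

text \<open>
  The excluded values form a countable set. The extra set \<open>F\<close> serves to make the chosen numbers
  distinct.
\<close>

lemma exists_transcendental_over:
  fixes E F :: "complex set"
  assumes "countable E" "countable F"
  shows "\<exists>z. z \<notin> F \<and> (\<forall>p. p \<noteq> 0 \<longrightarrow> (\<forall>i. coeff p i \<in> E) \<longrightarrow> poly p z \<noteq> 0)"
proof -
  define B where "B = (\<Union>p\<in>{p. \<forall>i. coeff p i \<in> E} - {0}. {z. poly p z = 0}) \<union> F"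
  have "countable B"
    unfolding B_def using assms countable_polys_over[OF assms(1)]
    by (intro countable_Un countable_UN countable_Diff) (auto intro!: countable_finite poly_roots_finite)
  have "\<not> range complex_of_real \<subseteq> B"
  proof
    assume "range complex_of_real \<subseteq> B"
    then have "countable (range complex_of_real)" using \<open>countable B\<close> countable_subset by blast
    then have "countable (UNIV :: real set)" by (rule countable_image_inj_on) (simp add: inj_of_real)
    then show False using uncountable_UNIV_real by blast
  qed
  then obtain r where "complex_of_real r \<notin> B" by blast
  then show ?thesis unfolding B_def by (intro exI[of _ "complex_of_real r"]) auto
qed

text \<open>
  The numbers are chosen one after the other, each transcendental over a countable set \<open>E\<close> that
  contains all values of rational polynomials at the earlier ones. Carrying \<open>E\<close> through the
  induction replaces a proof that there are only countably many polynomials in \<open>m\<close> variables.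
\<close>

lemma exists_monomial_independent:
  "\<exists>x E. countable E \<and> inj_on x {..<m} \<and> monomial_independent m x \<and>
     (\<forall>U (c :: (nat \<Rightarrow> nat) \<Rightarrow> rat). finite U \<longrightarrow> (\<Sum>u\<in>U. of_rat (c u) * (\<Prod>i<m. x i ^ u i)) \<in> E)"
proof (induction m)
  case 0
  have "c u = 0" if "finite U" "\<forall>u\<in>U. \<forall>i. u i = 0" "(\<Sum>u\<in>U. of_rat (c u)) = (0 :: complex)" "u \<in> U"
    for U :: "(nat \<Rightarrow> nat) set" and c :: "(nat \<Rightarrow> nat) \<Rightarrow> rat" and u
  proof -
    have "v = (\<lambda>_. 0)" if "v \<in> U" for v using that \<open>\<forall>u\<in>U. \<forall>i. u i = 0\<close> by auto
    then have "U = {u}" using \<open>u \<in> U\<close> by blast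
    then show "c u = 0" using that(3) by simp
  qed
  then have "monomial_independent 0 (\<lambda>_. 0)" by (auto simp: monomial_independent_def)
  moreover have "(\<Sum>u\<in>U. of_rat (c u)) \<in> range (of_rat :: rat \<Rightarrow> complex)"
    for U :: "(nat \<Rightarrow> nat) set" and c :: "(nat \<Rightarrow> nat) \<Rightarrow> rat"
    by (simp flip: of_rat_sum)
  ultimately show ?case
    by (intro exI[of _ "\<lambda>_. 0"] exI[of _ "range of_rat"]) simp
next
  case (Suc m)
  then obtain x E where E: "countable E" and inj: "inj_on x {..<m}" and ind: "monomial_independent m x"
    and inE: "\<And>U (c :: (nat \<Rightarrow> nat) \<Rightarrow> rat). finite U \<Longrightarrow> (\<Sum>u\<in>U. of_rat (c u) * (\<Prod>i<m. x i ^ u i)) \<in> E"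
    by blast
  obtain z where z: "z \<notin> x ` {..<m}" "\<And>p. p \<noteq> 0 \<Longrightarrow> (\<forall>i. coeff p i \<in> E) \<Longrightarrow> poly p z \<noteq> 0"
    using exists_transcendental_over[OF E, of "x ` {..<m}"] by auto
  define y where "y = x(m := z)"
  define pol where "pol U c = (\<Sum>u\<in>U. monom (of_rat (c u) * (\<Prod>i<m. x i ^ u i)) (u m))"
    for U and c :: "(nat \<Rightarrow> nat) \<Rightarrow> rat"
  have coeff_pol: "coeff (pol U c) d = (\<Sum>u\<in>{u\<in>U. u m = d}. of_rat (c u) * (\<Prod>i<m. x i ^ u i))"
    if "finite U" for U c d
    using that by (simp add: pol_def coeff_sum sum.inter_filter)
  have poly_pol: "poly (pol U c) z = (\<Sum>u\<in>U. of_rat (c u) * (\<Prod>i<Suc m. y i ^ u i))" for U c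
  proof -
    have "(\<Prod>i<m. y i ^ u i) = (\<Prod>i<m. x i ^ u i)" for u :: "nat \<Rightarrow> nat"
      by (rule prod.cong) (auto simp: y_def)
    then show ?thesis by (simp add: pol_def poly_sum poly_monom y_def mult_ac)
  qed
  have coeff_E: "coeff (pol U c) d \<in> E" if "finite U" for U c d
    unfolding coeff_pol[OF that] by (rule inE) (use that in simp)
  define E' where "E' = (\<lambda>p. poly p z) ` {p. \<forall>i. coeff p i \<in> E}"
  have "countable E'" unfolding E'_def by (intro countable_image countable_polys_over E)
  moreover have "inj_on y {..<Suc m}"
    using inj z(1) by (auto simp: y_def inj_on_def less_Suc_eq)
  moreover have "monomial_independent (Suc m) y"
    unfolding monomial_independent_def
  proof (intro allI impI ballI)
    fix U and c :: "(nat \<Rightarrow> nat) \<Rightarrow> rat" and u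
    assume U: "finite U" "\<forall>u\<in>U. \<forall>i\<ge>Suc m. u i = 0"
      "(\<Sum>u\<in>U. of_rat (c u) * (\<Prod>i<Suc m. y i ^ u i)) = 0" "u \<in> U"
    have "pol U c = 0" using z(2) coeff_E[OF U(1)] U(3) poly_pol by metis
    define V where "V = {v\<in>U. v m = u m}"
    define h where "h v = v(m := 0)" for v :: "nat \<Rightarrow> nat"
    have inj_h: "inj_on h V"
    proof (rule inj_onI)
      fix v w assume "v \<in> V" "w \<in> V" "h v = h w"
      moreover from \<open>v \<in> V\<close> have "v = (h v)(m := u m)" by (auto simp: V_def h_def)
      moreover from \<open>w \<in> V\<close> have "w = (h w)(m := u m)" by (auto simp: V_def h_def)
      ultimately show "v = w" by argo
    qed
    define c' where "c' v = c (the_inv_into V h v)" for v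
    have c': "c' (h v) = c v" if "v \<in> V" for v
      using the_inv_into_f_f[OF inj_h that] by (simp add: c'_def)
    have "(\<Sum>v\<in>h ` V. of_rat (c' v) * (\<Prod>i<m. x i ^ v i)) = (\<Sum>v\<in>V. of_rat (c v) * (\<Prod>i<m. x i ^ v i))"
      unfolding sum.reindex[OF inj_h]
    proof (rule sum.cong[OF refl])
      fix v assume "v \<in> V"
      moreover have "(\<Prod>i<m. x i ^ h v i) = (\<Prod>i<m. x i ^ v i)"
        by (rule prod.cong) (auto simp: h_def)
      ultimately show "((\<lambda>v. of_rat (c' v) * (\<Prod>i<m. x i ^ v i)) \<circ> h) v =
          of_rat (c v) * (\<Prod>i<m. x i ^ v i)"
        by (simp add: c')
    qed
    also have "\<dots> = coeff (pol U c) (u m)" by (simp add: coeff_pol[OF U(1)] V_def)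
    finally have "(\<Sum>v\<in>h ` V. of_rat (c' v) * (\<Prod>i<m. x i ^ v i)) = 0" using \<open>pol U c = 0\<close> by simp
    moreover have "finite (h ` V)" using U(1) by (simp add: V_def)
    moreover have "\<forall>v\<in>h ` V. \<forall>i\<ge>m. v i = 0"
      using U(2) by (auto simp: h_def V_def)
    ultimately have "\<forall>v\<in>h ` V. c' v = 0"
      using ind unfolding monomial_independent_def by blast
    then show "c u = 0" using c'[of u] U(4) by (simp add: V_def)
  qed
  moreover have "(\<Sum>u\<in>U. of_rat (c u) * (\<Prod>i<Suc m. y i ^ u i)) \<in> E'" if "finite U"
    for U and c :: "(nat \<Rightarrow> nat) \<Rightarrow> rat"
    unfolding E'_def poly_pol[symmetric] using coeff_E[OF that] by blast
  ultimately show ?case by blast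
qed

theorem exists_affine_alg_independent:
  "\<exists>\<Lambda>. length \<Lambda> = m \<and> distinct \<Lambda> \<and> affine_alg_independent \<Lambda>"
proof -
  obtain x where inj: "inj_on x {..<m}" and ind: "monomial_independent m x"
    using exists_monomial_independent[of m] by blast
  define \<Lambda> where "\<Lambda> = map x [0..<m]"
  have "affine_alg_independent \<Lambda>"
    unfolding affine_alg_independent_def
  proof (intro allI impI)
    fix R assume "affine_alg_dependence \<Lambda> R"
    then have R: "R \<in> mpolys_in m" and dep: "\<forall>a b. eval_mpoly R (\<lambda>i. a + b * \<Lambda> ! i) = 0"
      unfolding affine_alg_dependence_def by (simp_all add: \<Lambda>_def)
    from dep[rule_format, of 0 1] have ev: "eval_mpoly R (\<lambda>i. \<Lambda> ! i) = 0" by simp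
    define U where "U = Poly_Mapping.lookup ` Poly_Mapping.keys R"
    define c where "c f = Poly_Mapping.lookup R (Abs_poly_mapping f)" for f
    have inj_l: "inj_on Poly_Mapping.lookup (Poly_Mapping.keys R)"
      by (rule inj_onI) simp
    have "(\<Sum>f\<in>U. of_rat (c f) * (\<Prod>i<m. x i ^ f i)) = eval_mpoly R (\<lambda>i. \<Lambda> ! i)"
      unfolding U_def sum.reindex[OF inj_l] eval_mpoly_def
    proof (rule sum.cong[OF refl])
      fix u assume "u \<in> Poly_Mapping.keys R"
      then have "Poly_Mapping.keys u \<subseteq> {..<m}" using R by (auto simp: mpolys_in_def)
      then have "(\<Prod>i<m. x i ^ Poly_Mapping.lookup u i) =
          (\<Prod>i\<in>Poly_Mapping.keys u. \<Lambda> ! i ^ Poly_Mapping.lookup u i)"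
        by (intro prod.mono_neutral_cong_right) (auto simp: in_keys_iff \<Lambda>_def subset_iff)
      then show "((\<lambda>f. of_rat (c f) * (\<Prod>i<m. x i ^ f i)) \<circ> Poly_Mapping.lookup) u =
          of_rat (Poly_Mapping.lookup R u) *
          (\<Prod>i\<in>Poly_Mapping.keys u. \<Lambda> ! i ^ Poly_Mapping.lookup u i)"
        by (simp add: c_def lookup_inverse)
    qed
    moreover have "finite U" by (simp add: U_def)
    moreover have "\<forall>f\<in>U. \<forall>i\<ge>m. f i = 0"
    proof (intro ballI allI impI)
      fix f i assume "f \<in> U" "m \<le> i"
      then obtain u where "u \<in> Poly_Mapping.keys R" "f = Poly_Mapping.lookup u" by (auto simp: U_def)
      then show "f i = 0" using R \<open>m \<le> i\<close> unfolding mpolys_in_def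
        by (metis (mono_tags, lifting) in_keys_iff lessThan_iff linorder_not_le mem_Collect_eq subset_eq)
    qed
    ultimately have "\<forall>f\<in>U. c f = 0"
      using ind ev unfolding monomial_independent_def by simp
    then have "\<forall>u. Poly_Mapping.lookup R u = 0"
      by (auto simp: U_def c_def lookup_inverse in_keys_iff)
    then show "R = 0" by (intro poly_mapping_eqI) simp
  qed
  moreover have "distinct \<Lambda>" "length \<Lambda> = m"
    using inj by (simp_all add: \<Lambda>_def distinct_map atLeast0LessThan)
  ultimately show ?thesis by blast
qed

section \<open>Counting admissible patterns\<close>

text \<open>
  Polya's condition. For \<open>L = n + 1\<close> it bounds the number of zeros of order at least \<open>t\<close> by the degree
  \<open>n - t\<close> of the derivative of order \<open>t\<close>.
\<close>

definition admissible :: "nat \<Rightarrow> nat \<Rightarrow> (nat \<times> nat) set set" where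
  "admissible m L = {S. S \<subseteq> {..<m} \<times> {..<L} \<and> (\<forall>t<L. card {c\<in>S. t \<le> snd c} < L - t)}"

text \<open>
  Delete the column of order 0 and shift the others. The bound for \<open>t = 0\<close> only says that there
  are at most \<open>L\<close> elements, which \<open>k \<le> L\<close> ensures whatever the deleted column was.
\<close>

lemma card_admissible_Suc:
  assumes "k \<le> L"
  shows "card {S\<in>admissible m (Suc L). card S = k} =
    (\<Sum>c\<le>k. (m choose c) * card {S\<in>admissible m L. card S = k - c})"
proof -
  define sh where "sh S = (\<lambda>(i, j). (i, Suc j)) ` S" for S :: "(nat \<times> nat) set"
  define X where "X = (SIGMA c:{..k}. {C. C \<subseteq> {..<m} \<and> card C = c} \<times> {S\<in>admissible m L. card S = k - c})"
  define Y where "Y = {S\<in>admissible m (Suc L). card S = k}"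
  define f where "f = (\<lambda>(c :: nat, C, S). C \<times> {0} \<union> sh S)"
  define g where "g = (\<lambda>S :: (nat \<times> nat) set. (card {i. (i, 0) \<in> S}, {i. (i, 0) \<in> S}, {(i, j). (i, Suc j) \<in> S}))"
  have sh_iff: "(i, 0) \<notin> sh S" "(i, Suc j) \<in> sh S \<longleftrightarrow> (i, j) \<in> S" for i j S
    by (force simp: sh_def)+
  have sh_cond: "card {c\<in>C \<times> {0} \<union> sh S. Suc t \<le> snd c} = card {c\<in>S. t \<le> snd c}" for C :: "nat set" and S t
  proof -
    have "{c\<in>C \<times> {0} \<union> sh S. Suc t \<le> snd c} = sh {c\<in>S. t \<le> snd c}"
      by (force simp: sh_def)
    then show ?thesis by (simp add: sh_def card_image inj_on_def split_beta prod_eq_iff)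
  qed
  have cardf: "card (C \<times> {0} \<union> sh S) = card C + card S" if "finite C" "finite S" for C :: "nat set" and S
  proof -
    have "card (C \<times> {0} \<union> sh S) = card (C \<times> {0 :: nat}) + card (sh S)"
      by (rule card_Un_disjoint) (use that in \<open>auto simp: sh_def\<close>)
    then show ?thesis by (simp add: sh_def card_image inj_on_def split_beta prod_eq_iff card_cartesian_product)
  qed
  have finX: "finite C" "finite S" if "C \<subseteq> {..<m}" "S \<subseteq> {..<m} \<times> {..<L}" for C S
    using that finite_subset by blast+
  have adm: "C \<times> {0} \<union> sh S \<in> admissible m (Suc L) \<longleftrightarrow> S \<in> admissible m L"
    if "C \<subseteq> {..<m}" "S \<subseteq> {..<m} \<times> {..<L}" "card C + card S \<le> L" for C S
  proof -
    have sub: "C \<times> {0} \<union> sh S \<subseteq> {..<m} \<times> {..<Suc L}"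
      using that(1,2) by (auto simp: sh_def)
    have "(\<forall>t<Suc L. card {c\<in>C \<times> {0} \<union> sh S. t \<le> snd c} < Suc L - t) \<longleftrightarrow>
      card (C \<times> {0} \<union> sh S) < Suc L \<and>
      (\<forall>t<L. card {c\<in>C \<times> {0} \<union> sh S. Suc t \<le> snd c} < Suc L - Suc t)"
      by (subst All_less_Suc2) (simp del: Un_iff)
    also have "\<dots> \<longleftrightarrow> (\<forall>t<L. card {c\<in>S. t \<le> snd c} < L - t)"
      using that(3) by (simp add: sh_cond cardf[OF finX[OF that(1,2)]] del: Un_iff)
    finally show ?thesis using sub that(2) by (simp add: admissible_def)
  qed
  have fg: "C \<times> {0} \<union> sh S = T" if "C = {i. (i, 0) \<in> T}" "S = {(i, j). (i, Suc j) \<in> T}" for C S T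
  proof (rule Set.set_eqI)
    fix c :: "nat \<times> nat"
    obtain i j where c: "c = (i, j)" by force
    show "c \<in> C \<times> {0} \<union> sh S \<longleftrightarrow> c \<in> T"
      unfolding c that by (cases j) (auto simp: sh_iff)
  qed
  have "bij_betw f X Y"
  proof (rule bij_betw_byWitness[where f' = g])
    show "\<forall>x\<in>X. g (f x) = x"
    proof
      fix x assume x: "x \<in> X"
      obtain c C S where xe: "x = (c, C, S)" by (metis prod_cases3)
      have "{i. (i, 0) \<in> C \<times> {0} \<union> sh S} = C" "{(i, j). (i, Suc j) \<in> C \<times> {0} \<union> sh S} = S"
        by (auto simp: sh_iff)
      then show "g (f x) = x" using x unfolding xe by (simp add: f_def g_def X_def)
    qed
    show "\<forall>T\<in>Y. f (g T) = T"
      by (simp add: f_def g_def fg)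
    show "f ` X \<subseteq> Y"
    proof
      fix T assume "T \<in> f ` X"
      then obtain c C S where T: "T = C \<times> {0} \<union> sh S" "(c, C, S) \<in> X" by (force simp: f_def)
      then have *: "c \<le> k" "C \<subseteq> {..<m}" "card C = c" "S \<in> admissible m L" "card S = k - c"
        by (auto simp: X_def)
      then have S: "S \<subseteq> {..<m} \<times> {..<L}" by (simp add: admissible_def)
      then show "T \<in> Y"
        using * adm[OF *(2) S] cardf[OF finX[OF *(2) S]] assms T(1) by (simp add: Y_def)
    qed
    show "g ` Y \<subseteq> X"
    proof
      fix x assume "x \<in> g ` Y"
      then obtain T where T: "T \<in> Y" "x = g T" by blast
      define C where "C = {i. (i, 0) \<in> T}"
      define S where "S = {(i, j). (i, Suc j) \<in> T}"
      have eq: "C \<times> {0} \<union> sh S = T" by (rule fg) (simp_all add: C_def S_def)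
      have sub: "T \<subseteq> {..<m} \<times> {..<Suc L}" "card T = k" using T by (auto simp: Y_def admissible_def)
      then have CS: "C \<subseteq> {..<m}" "S \<subseteq> {..<m} \<times> {..<L}" by (auto simp: C_def S_def)
      have "card C + card S = k" using cardf[OF finX[OF CS]] eq sub by simp
      then show "x \<in> X"
        using adm[OF CS] T assms CS eq by (auto simp: X_def Y_def g_def C_def[symmetric] S_def[symmetric])
    qed
  qed
  then have "card Y = card X" by (simp add: bij_betw_same_card)
  also have "\<dots> = (\<Sum>c\<le>k. (m choose c) * card {S\<in>admissible m L. card S = k - c})"
  proof -
    have "finite (admissible m L)"
      by (rule finite_subset[of _ "Pow ({..<m} \<times> {..<L})"]) (auto simp: admissible_def)
    then show ?thesis
      unfolding X_def by (subst card_SigmaI) (auto simp: card_cartesian_product n_subsets)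
  qed
  finally show ?thesis by (simp add: Y_def)
qed

text \<open>
  This is \<open>(L - k) / L\<close> times the binomial coefficient of \<open>L m\<close> over \<open>k\<close>. In this form it is an
  integer and also correct for \<open>L = 0\<close>, and both terms are binomial coefficients to which
  Vandermonde's identity applies.
\<close>

definition ballot_number :: "nat \<Rightarrow> nat \<Rightarrow> nat \<Rightarrow> int" where
  "ballot_number m L k =
     int ((L * m) choose k) - int m * (case k of 0 \<Rightarrow> 0 | Suc k' \<Rightarrow> int ((L * m - 1) choose k'))"

lemma ballot_number_convolution:
  assumes "k \<le> L"
  shows "(\<Sum>c\<le>k. int (m choose c) * ballot_number m L (k - c)) = ballot_number m (Suc L) k"
proof (cases "m = 0 \<or> k = 0")
  case True
  then show ?thesis
  proof
    assume "m = 0"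
    then have "(\<Sum>c\<le>k. int (m choose c) * ballot_number m L (k - c)) =
        (\<Sum>c\<in>{0}. ballot_number m L (k - c))"
      by (intro sum.mono_neutral_cong_right) auto
    then show ?thesis using \<open>m = 0\<close> by (simp add: ballot_number_def)
  qed (simp add: ballot_number_def)
next
  case False
  then have "0 < m" "0 < k" by auto
  then obtain k' where k: "k = Suc k'" using gr0_implies_Suc by blast
  have "0 < L * m" using \<open>0 < m\<close> k assms by simp
  have "(\<Sum>c\<le>k. int (m choose c) * ballot_number m L (k - c)) =
      (\<Sum>c\<le>k. int ((m choose c) * ((L * m) choose (k - c)))) -
      int m * (\<Sum>c\<le>k. int (m choose c) * (case k - c of 0 \<Rightarrow> 0 | Suc i \<Rightarrow> int ((L * m - 1) choose i)))"
    by (simp add: ballot_number_def right_diff_distrib sum_subtractf sum_distrib_left mult_ac)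
  also have "(\<Sum>c\<le>k. int ((m choose c) * ((L * m) choose (k - c)))) = int ((Suc L * m) choose k)"
    using vandermonde[of m "L * m" k] by (simp flip: of_nat_sum of_nat_mult)
  also have "(\<Sum>c\<le>k. int (m choose c) * (case k - c of 0 \<Rightarrow> 0 | Suc i \<Rightarrow> int ((L * m - 1) choose i))) =
      (\<Sum>c\<le>k'. int ((m choose c) * ((L * m - 1) choose (k' - c))))"
    unfolding k by (simp add: Suc_diff_le)
  also have "\<dots> = int ((m + (L * m - 1)) choose k')"
    using vandermonde[of m "L * m - 1" k'] by (simp flip: of_nat_sum of_nat_mult)
  also have "m + (L * m - 1) = Suc L * m - 1" using \<open>0 < L * m\<close> by simp
  finally show ?thesis by (simp add: ballot_number_def k)
qed

text \<open>
  For \<open>k = L > 0\<close> no admissible set has \<open>k\<close> elements and the ballot number is 0. Including this boundary case in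
  the induction makes the recursion apply up to \<open>k = L\<close> in the next step.
\<close>

lemma card_admissible:
  assumes "k \<le> L"
  shows "int (card {S\<in>admissible m L. card S = k}) = ballot_number m L k"
  using assms
proof (induction L arbitrary: k)
  case 0
  have "{S\<in>admissible m 0. card S = 0} = {{}}" by (auto simp: admissible_def)
  with 0 show ?case by (simp add: ballot_number_def)
next
  case (Suc L)
  show ?case
  proof (cases "k \<le> L")
    case True
    have "int (card {S\<in>admissible m (Suc L). card S = k}) =
        (\<Sum>c\<le>k. int (m choose c) * int (card {S\<in>admissible m L. card S = k - c}))"
      by (simp add: card_admissible_Suc[OF True])
    also have "\<dots> = (\<Sum>c\<le>k. int (m choose c) * ballot_number m L (k - c))"
      using Suc.IH True by simp
    also have "\<dots> = ballot_number m (Suc L) k"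
      by (rule ballot_number_convolution[OF True])
    finally show ?thesis .
  next
    case False
    then have k: "k = Suc L" using Suc.prems by simp
    have "{S\<in>admissible m (Suc L). card S = k} = {}" using k by (auto simp: admissible_def)
    moreover have "ballot_number m (Suc L) k = 0"
    proof (cases "m = 0")
      case False
      have "Suc L * ((Suc L * m) choose Suc L) = (Suc L * m) * ((Suc L * m - 1) choose L)"
        using binomial_absorption[of L "Suc L * m"] by simp
      then have "(Suc L * m) choose Suc L = m * ((Suc L * m - 1) choose L)"
        by (metis mult.assoc nat.distinct(1) nat_mult_eq_cancel_disj)
      then show ?thesis by (simp add: ballot_number_def k)
    qed (simp add: ballot_number_def k)
    ultimately show ?thesis by (simp only: card.empty of_nat_0)
  qed
qed

lemma ballot_number_real:
  assumes "0 < L"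
  shows "real_of_int (ballot_number m L k) = (real L - real k) / real L * real ((L * m) choose k)"
proof (cases k)
  case (Suc k')
  have "Suc k' * ((L * m) choose Suc k') = (L * m) * ((L * m - 1) choose k')"
    using binomial_absorption[of k' "L * m"] by simp
  then have "real (Suc k') * real ((L * m) choose Suc k') = real L * (real m * real ((L * m - 1) choose k'))"
    by (metis of_nat_mult mult.assoc)
  then show ?thesis using assms by (simp add: ballot_number_def Suc field_simps)
qed (use assms in \<open>simp add: ballot_number_def\<close>)

text \<open>
  By Pascal's rule, the summand for \<open>k > 0\<close> is the binomial coefficient of \<open>L m - 1\<close> over \<open>k\<close>
  minus \<open>m - 1\<close> times that over \<open>k - 1\<close>.
\<close>

lemma sum_ballot_number:
  assumes "0 < m" "0 < L"
  shows "(\<Sum>k\<le>n. ballot_number m L k) =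
    int ((L * m - 1) choose n) - (int m - 2) * (\<Sum>k = 0..<n. int ((L * m - 1) choose k))"
proof (induction n)
  case (Suc n)
  have "L * m = Suc (L * m - 1)" using assms by simp
  then have "(L * m) choose Suc n = ((L * m - 1) choose n) + ((L * m - 1) choose Suc n)"
    by (metis binomial_Suc_Suc)
  then have "ballot_number m L (Suc n) = int ((L * m - 1) choose Suc n) + int ((L * m - 1) choose n)
      - int m * int ((L * m - 1) choose n)"
    by (simp add: ballot_number_def)
  then show ?case using Suc by (simp add: algebra_simps)
qed (simp add: ballot_number_def)

section \<open>Zero patterns of polynomials at generic nodes\<close>

abbreviation deriv_at :: "nat \<times> nat \<Rightarrow> complex list \<Rightarrow> complex poly \<Rightarrow> complex" where
  "deriv_at c \<Lambda> P \<equiv> poly ((pderiv ^^ snd c) P) (\<Lambda> ! fst c)"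

definition zero_pattern :: "complex poly \<Rightarrow> complex list \<Rightarrow> (nat \<times> nat) set" where
  "zero_pattern P \<Lambda> = {c \<in> {..<length \<Lambda>} \<times> {..<Suc (degree P)}. deriv_at c \<Lambda> P = 0}"

definition pattern_matrix :: "nat \<Rightarrow> nat \<Rightarrow> (nat \<times> nat) set \<Rightarrow> nat mat" where
  "pattern_matrix m L S = mat m L (\<lambda>c. if c \<in> S then 1 else 0)"

lemma dope_matrix_eq_pattern_matrix:
  "dope_matrix P \<Lambda> = pattern_matrix (length \<Lambda>) (Suc (degree P)) (zero_pattern P \<Lambda>)"
  unfolding dope_matrix_def pattern_matrix_def by (rule eq_matI) (auto simp: zero_pattern_def)

lemma ones_pattern_matrix:
  assumes "S \<subseteq> {..<m} \<times> {..<L}"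
  shows "{(i, j). i < dim_row (pattern_matrix m L S) \<and> j < dim_col (pattern_matrix m L S) \<and>
    pattern_matrix m L S $$ (i, j) = 1} = S"
  using assms by (auto simp: pattern_matrix_def split: if_splits)

lemma num_ones_pattern_matrix:
  "S \<subseteq> {..<m} \<times> {..<L} \<Longrightarrow> num_ones (pattern_matrix m L S) = card S"
  unfolding num_ones_def by (simp only: ones_pattern_matrix)

lemma inj_on_pattern_matrix: "inj_on (pattern_matrix m L) (Pow ({..<m} \<times> {..<L}))"
proof (rule inj_onI)
  fix S T :: "(nat \<times> nat) set"
  assume S: "S \<in> Pow ({..<m} \<times> {..<L})" and T: "T \<in> Pow ({..<m} \<times> {..<L})"
    and eq: "pattern_matrix m L S = pattern_matrix m L T"
  show "S = T"
    using ones_pattern_matrix[OF PowD[OF S]] ones_pattern_matrix[OF PowD[OF T]]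
    unfolding eq by (rule trans[OF sym])
qed

lemma unisolvent_deriv_at:
  assumes "unisolvent (\<lambda>i. \<Lambda> ! i) S {..<N}" "degree P < N" "\<And>c. c \<in> S \<Longrightarrow> deriv_at c \<Lambda> P = 0"
  shows "P = 0"
  using assms unfolding unisolvent_iff_poly by blast

lemma higher_pderiv_eq_0_iff:
  fixes P :: "'a::field_char_0 poly"
  assumes "P \<noteq> 0"
  shows "(pderiv ^^ t) P = 0 \<longleftrightarrow> degree P < t"
proof
  assume 0: "(pderiv ^^ t) P = 0"
  show "degree P < t"
  proof (rule ccontr)
    assume "\<not> degree P < t"
    then have "coeff ((pderiv ^^ t) P) (degree P - t) = pochhammer (of_nat (Suc (degree P - t))) t * lead_coeff P"
      by (simp add: coeff_higher_pderiv del: of_nat_Suc)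
    moreover have "pochhammer (of_nat (Suc (degree P - t))) t \<noteq> (0 :: 'a)"
      unfolding pochhammer_of_nat of_nat_eq_0_iff
      using pochhammer_pos[of "Suc (degree P - t)" t] by simp
    ultimately show False using 0 assms by simp
  qed
next
  assume "degree P < t"
  then show "(pderiv ^^ t) P = 0"
    by (intro poly_eqI) (simp add: coeff_higher_pderiv coeff_eq_0)
qed

text \<open>
  Suppose that there are too many zeros of order at least \<open>t\<close>, and let \<open>t0\<close> be the largest such \<open>t\<close>.
  Above \<open>t0\<close> the bounds hold, so all zeros of larger order together with suitably many of order
  \<open>t0\<close> form a set \<open>T\<close> of \<open>n + 1 - t0\<close> conditions that, shifted by \<open>t0\<close>, is unisolvent. But the
  derivative of order \<open>t0\<close> is a nonzero polynomial that satisfies them.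
\<close>

lemma zero_pattern_admissible:
  assumes indep: "affine_alg_independent \<Lambda>" and "P \<noteq> 0"
  shows "zero_pattern P \<Lambda> \<in> admissible (length \<Lambda>) (Suc (degree P))"
proof -
  define n where "n = degree P"
  define S where "S = zero_pattern P \<Lambda>"
  have S: "S \<subseteq> {..<length \<Lambda>} \<times> {..<Suc n}" "\<And>c. c \<in> S \<Longrightarrow> deriv_at c \<Lambda> P = 0"
    by (auto simp: S_def zero_pattern_def n_def)
  have finS: "finite S" using S(1) finite_subset by blast
  define full where "full t \<longleftrightarrow> t \<le> n \<and> Suc n - t \<le> card {c\<in>S. t \<le> snd c}" for t
  have "\<not> full t" for t
  proof
    assume "full t"
    define t0 where "t0 = Max {t. full t}"
    have finF: "finite {t. full t}" by (rule finite_subset[of _ "{..n}"]) (auto simp: full_def)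
    have "full t0" unfolding t0_def using Max_in[OF finF] \<open>full t\<close> by blast
    have max: "\<not> full r" if "t0 < r" for r
      using that Max_ge[OF finF, of r] by (auto simp: t0_def)
    have above: "card {c\<in>S. r \<le> snd c} \<le> n - r" if "t0 < r" for r
    proof (cases "r \<le> n")
      case True
      then show ?thesis using max[OF that] by (auto simp: full_def)
    next
      case False
      then have "{c\<in>S. r \<le> snd c} = {}" using S(1) by auto
      then show ?thesis by (simp only: card.empty)
    qed
    have t0: "t0 \<le> n" "Suc n - t0 \<le> card {c\<in>S. t0 \<le> snd c}" using \<open>full t0\<close> by (auto simp: full_def)
    have "card {c\<in>S. Suc t0 \<le> snd c} \<le> Suc n - t0" using above[of "Suc t0"] by simp
    moreover have "{c\<in>S. Suc t0 \<le> snd c} \<subseteq> {c\<in>S. t0 \<le> snd c}" by auto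
    ultimately obtain T where T: "{c\<in>S. Suc t0 \<le> snd c} \<subseteq> T" "T \<subseteq> {c\<in>S. t0 \<le> snd c}" "card T = Suc n - t0"
      using exists_subset_between[of "{c\<in>S. Suc t0 \<le> snd c}" "Suc n - t0" "{c\<in>S. t0 \<le> snd c}"] t0(2) finS
      by auto
    define sh where "sh = (\<lambda>c :: nat \<times> nat. (fst c, snd c - t0))"
    have inj: "inj_on sh T"
    proof (rule inj_onI)
      fix c d assume "c \<in> T" "d \<in> T" "sh c = sh d"
      moreover from this have "t0 \<le> snd c" "t0 \<le> snd d" using T(2) by auto
      ultimately show "c = d" by (auto simp: sh_def intro: prod_eqI)
    qed
    have finT: "finite T" using T(2) finS finite_subset by fastforce
    have shT: "sh ` T \<subseteq> {..<length \<Lambda>} \<times> UNIV" "finite (sh ` T)" "card (sh ` T) = Suc n - t0"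
      using T(2,3) S(1) finT card_image[OF inj] by (auto simp: sh_def)
    have "card {c\<in>sh ` T. r \<le> snd c} \<le> Suc n - t0 - r" for r
    proof (cases r)
      case 0
      then show ?thesis using shT(3) by simp
    next
      case (Suc r')
      have "{c\<in>sh ` T. r \<le> snd c} \<subseteq> sh ` {c\<in>S. t0 + r \<le> snd c}"
        using T(2) Suc by (auto simp: sh_def)
      then have "card {c\<in>sh ` T. r \<le> snd c} \<le> card (sh ` {c\<in>S. t0 + r \<le> snd c})"
        by (intro card_mono finite_imageI) (simp add: finS)
      also have "\<dots> \<le> card {c\<in>S. t0 + r \<le> snd c}"
        by (rule card_image_le) (simp add: finS)
      also have "\<dots> \<le> n - (t0 + r)" using above[of "t0 + r"] Suc by simp
      finally show ?thesis by simp
    qed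
    then have "unisolvent (\<lambda>i. \<Lambda> ! i) (sh ` T) {..<Suc n - t0}"
      by (rule affine_alg_independent_unisolvent[OF indep shT])
    moreover have "degree ((pderiv ^^ t0) P) < Suc n - t0"
      using t0(1) by (simp add: degree_higher_pderiv n_def[symmetric])
    moreover have "deriv_at c \<Lambda> ((pderiv ^^ t0) P) = 0" if "c \<in> sh ` T" for c
    proof -
      obtain d where d: "d \<in> T" "c = sh d" using \<open>c \<in> sh ` T\<close> by blast
      then have "d \<in> S" "t0 \<le> snd d" using T(2) by auto
      then have "(pderiv ^^ snd c) ((pderiv ^^ t0) P) = (pderiv ^^ snd d) P"
        using fun_cong[OF funpow_add[of "snd c" t0 pderiv], of P] d(2) by (simp add: sh_def)
      then show ?thesis using S(2)[OF \<open>d \<in> S\<close>] d(2) by (simp add: sh_def)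
    qed
    ultimately have "(pderiv ^^ t0) P = 0" by (rule unisolvent_deriv_at)
    then show False using higher_pderiv_eq_0_iff[OF assms(2)] t0(1) n_def by simp
  qed
  then have "card {c\<in>S. t \<le> snd c} < Suc n - t" if "t < Suc n" for t
    using that unfolding full_def by (meson less_Suc_eq_le not_le)
  then show ?thesis
    using S(1) unfolding S_def[symmetric] n_def[symmetric] admissible_def by blast
qed

text \<open>
  Let \<open>t\<close> be the least order at which the bound is attained. If \<open>t = 0\<close> the pattern is full.
  Otherwise no position of order \<open>t - 1\<close> is occupied, since the bound there is strict, and the
  position of order \<open>t - 1\<close> at the first node can be added.
\<close>

lemma extend_to_full_pattern:
  fixes m N :: nat
  assumes "0 < m" "S \<subseteq> {..<m} \<times> {..<N}" "\<And>t. card {c\<in>S. t \<le> snd c} \<le> N - t"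
  shows "\<exists>T. S \<subseteq> T \<and> T \<subseteq> {..<m} \<times> {..<N} \<and> card T = N \<and> (\<forall>t. card {c\<in>T. t \<le> snd c} \<le> N - t)"
  using assms(2,3)
proof (induction "N - card S" arbitrary: S)
  case 0
  have "card S = N" using "0.hyps" "0.prems"(2)[of 0] by simp
  show ?case
    by (intro exI[of _ S] conjI allI order_refl) (fact "0.prems"(1) \<open>card S = N\<close> "0.prems"(2))+
next
  case (Suc d)
  have finS: "finite S" by (rule finite_subset[OF Suc.prems(1)]) simp
  define t where "t = (LEAST t. card {c\<in>S. t \<le> snd c} = N - t)"
  have N: "card {c\<in>S. N \<le> snd c} = N - N" using Suc.prems(2)[of N] by simp
  have t: "card {c\<in>S. t \<le> snd c} = N - t" unfolding t_def by (rule LeastI) (rule N)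
  have tN: "t \<le> N" unfolding t_def by (rule Least_le) (rule N)
  have "t \<noteq> 0" using t Suc.hyps(2) by (cases "t = 0") auto
  then obtain t' where t': "t = Suc t'" using not0_implies_Suc by blast
  have strict: "card {c\<in>S. r \<le> snd c} < N - r" if "r \<le> t'" for r
    using not_less_Least[of r "\<lambda>t. card {c\<in>S. t \<le> snd c} = N - t"] that t' Suc.prems(2)[of r]
    unfolding t_def[symmetric] by (simp add: le_less)
  have notin: "(0, t') \<notin> S"
  proof
    assume "(0, t') \<in> S"
    then have "insert (0, t') {c\<in>S. t \<le> snd c} \<subseteq> {c\<in>S. t' \<le> snd c}" using t' by auto
    then have "card (insert (0, t') {c\<in>S. t \<le> snd c}) \<le> card {c\<in>S. t' \<le> snd c}"
      using finS by (intro card_mono) auto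
    moreover have "card (insert (0, t') {c\<in>S. t \<le> snd c}) = Suc (card {c\<in>S. t \<le> snd c})"
      using finS t' by (intro card_insert_disjoint) auto
    ultimately show False using strict[of t'] t tN t' by simp
  qed
  define S' where "S' = insert (0, t') S"
  have "card {c\<in>S'. r \<le> snd c} \<le> N - r" for r
  proof (cases "r \<le> t'")
    case True
    then have "{c\<in>S'. r \<le> snd c} = insert (0, t') {c\<in>S. r \<le> snd c}" by (auto simp: S'_def)
    then have "card {c\<in>S'. r \<le> snd c} \<le> Suc (card {c\<in>S. r \<le> snd c})"
      by (simp add: card_insert_le_m1 card_insert_if finS)
    then show ?thesis using strict[OF True] by simp
  next
    case False
    then have "{c\<in>S'. r \<le> snd c} = {c\<in>S. r \<le> snd c}" by (auto simp: S'_def)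
    then show ?thesis using Suc.prems(2)[of r] by simp
  qed
  moreover have "S' \<subseteq> {..<m} \<times> {..<N}" using Suc.prems(1) tN t' assms(1) by (auto simp: S'_def)
  moreover have "d = N - card S'" using Suc.hyps(2) notin finS by (simp add: S'_def)
  ultimately have "\<exists>T. S' \<subseteq> T \<and> T \<subseteq> {..<m} \<times> {..<N} \<and> card T = N \<and> (\<forall>t. card {c\<in>T. t \<le> snd c} \<le> N - t)"
    using Suc.hyps(1)[of S'] by simp
  then show ?case by (auto simp: S'_def)
qed

text \<open>
  The bounds for an admissible set are one less than those needed for unisolvence, so adding
  \<open>c0\<close> still leaves a pattern that extends to a unisolvent one. Dropping the
  condition \<open>c0\<close> from it leaves a nonzero solution, which cannot also satisfy \<open>c0\<close>.
\<close>

lemma exists_poly_separating_position: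
  assumes indep: "affine_alg_independent \<Lambda>" and "length \<Lambda> > 0"
    and adm: "S \<in> admissible (length \<Lambda>) (Suc n)"
    and c0: "c0 \<in> {..<length \<Lambda>} \<times> {..<Suc n} - S"
  shows "\<exists>P. degree P \<le> n \<and> (\<forall>c\<in>S. deriv_at c \<Lambda> P = 0) \<and> deriv_at c0 \<Lambda> P \<noteq> 0"
proof -
  define m where "m = length \<Lambda>"
  have S: "S \<subseteq> {..<m} \<times> {..<Suc n}" "\<And>t. t < Suc n \<Longrightarrow> card {c\<in>S. t \<le> snd c} < Suc n - t"
    using adm by (auto simp: admissible_def m_def)
  have finS: "finite S" using S(1) finite_subset by blast
  have sub: "insert c0 S \<subseteq> {..<m} \<times> {..<Suc n}" using c0 S(1) by (auto simp: m_def)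
  have dom: "card {c\<in>insert c0 S. t \<le> snd c} \<le> Suc n - t" for t
  proof (cases "t < Suc n")
    case True
    have "card {c\<in>insert c0 S. t \<le> snd c} \<le> card (insert c0 {c\<in>S. t \<le> snd c})"
      using finS by (intro card_mono) auto
    also have "\<dots> \<le> Suc (card {c\<in>S. t \<le> snd c})" by (simp add: card_insert_if finS)
    finally show ?thesis using S(2)[OF True] by simp
  next
    case False
    then have "{c\<in>insert c0 S. t \<le> snd c} = {}" using sub by auto
    then show ?thesis by (simp only: card.empty)
  qed
  have "0 < m" using assms(2) by (simp add: m_def)
  from extend_to_full_pattern[OF this sub dom] obtain T where T: "insert c0 S \<subseteq> T"
    "T \<subseteq> {..<m} \<times> {..<Suc n}" "card T = Suc n" "\<And>t. card {c\<in>T. t \<le> snd c} \<le> Suc n - t"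
    by blast
  have finT: "finite T" using T(2) finite_subset by blast
  have "T \<subseteq> {..<length \<Lambda>} \<times> UNIV" using T(2) m_def by auto
  then have uni: "unisolvent (\<lambda>i. \<Lambda> ! i) T {..<Suc n}"
    by (rule affine_alg_independent_unisolvent[OF indep _ finT T(3,4)])
  have "card (T - {c0}) < card {..<Suc n}" using T(1,3) finT by simp
  then have "\<not> unisolvent (\<lambda>i. \<Lambda> ! i) (T - {c0}) {..<Suc n}"
    using underdetermined_system_has_solution[of "T - {c0}" "{..<Suc n}" "birkhoff_entry (\<lambda>i. \<Lambda> ! i)"] finT
    unfolding unisolvent_def by blast
  then obtain P where P: "P \<noteq> 0" "degree P < Suc n" "\<forall>c\<in>T - {c0}. deriv_at c \<Lambda> P = 0"
    unfolding unisolvent_iff_poly by blast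
  have "deriv_at c0 \<Lambda> P \<noteq> 0"
    using unisolvent_deriv_at[OF uni P(2)] P(1,3) by blast
  moreover have "\<forall>c\<in>S. deriv_at c \<Lambda> P = 0" using P(3) T(1) c0 by auto
  ultimately show ?thesis using P(2) by (intro exI[of _ P]) simp
qed

text \<open>
  A complex vector space is not a finite union of proper subspaces: along a line \<open>Q + t P\<close> only
  finitely many \<open>t\<close> have to be avoided.
\<close>

lemma exists_poly_avoiding_zeros:
  assumes "finite Z" "\<And>c. c \<in> Z \<Longrightarrow>
    \<exists>P. degree P \<le> n \<and> (\<forall>c\<in>S. deriv_at c \<Lambda> P = 0) \<and> deriv_at c \<Lambda> P \<noteq> 0"
  shows "\<exists>P. degree P \<le> n \<and> (\<forall>c\<in>S. deriv_at c \<Lambda> P = 0) \<and> (\<forall>c\<in>Z. deriv_at c \<Lambda> P \<noteq> 0)"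
  using assms
proof (induction Z)
  case empty
  show ?case by (intro exI[of _ 0]) simp
next
  case (insert c Z)
  then obtain Q where Q: "degree Q \<le> n" "\<forall>c\<in>S. deriv_at c \<Lambda> Q = 0" "\<forall>c\<in>Z. deriv_at c \<Lambda> Q \<noteq> 0" by blast
  obtain P where P: "degree P \<le> n" "\<forall>c\<in>S. deriv_at c \<Lambda> P = 0" "deriv_at c \<Lambda> P \<noteq> 0"
    using insert.prems by blast
  have lin: "deriv_at d \<Lambda> (Q + Polynomial.smult t P) = deriv_at d \<Lambda> Q + t * deriv_at d \<Lambda> P" for d t
    by (simp add: higher_pderiv_add higher_pderiv_smult)
  have "finite {t. deriv_at d \<Lambda> Q + t * deriv_at d \<Lambda> P = 0}" if "d \<in> insert c Z" for d
  proof (cases "deriv_at d \<Lambda> P = 0")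
    case True
    then have "deriv_at d \<Lambda> Q \<noteq> 0" using that Q(3) P(3) by auto
    then show ?thesis using True by simp
  next
    case False
    then have "{t. deriv_at d \<Lambda> Q + t * deriv_at d \<Lambda> P = 0} \<subseteq> {- deriv_at d \<Lambda> Q / deriv_at d \<Lambda> P}"
      by (auto simp: field_simps add_eq_0_iff)
    then show ?thesis using finite_subset by blast
  qed
  then have "finite (\<Union>d\<in>insert c Z. {t. deriv_at d \<Lambda> Q + t * deriv_at d \<Lambda> P = 0})"
    using insert.hyps(1) by blast
  then obtain t where t: "t \<notin> (\<Union>d\<in>insert c Z. {t. deriv_at d \<Lambda> Q + t * deriv_at d \<Lambda> P = 0})"
    using ex_new_if_finite[OF infinite_UNIV_char_0] by blast
  have "degree (Q + Polynomial.smult t P) \<le> n"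
    using Q(1) P(1) by (intro degree_add_le order_trans[OF degree_smult_le])
  moreover have "\<forall>d\<in>S. deriv_at d \<Lambda> (Q + Polynomial.smult t P) = 0" using Q(2) P(2) unfolding lin by simp
  moreover have "\<forall>d\<in>insert c Z. deriv_at d \<Lambda> (Q + Polynomial.smult t P) \<noteq> 0" using t unfolding lin by blast
  ultimately show ?case by blast
qed

text \<open>
  The position \<open>(0, n)\<close> is never in an admissible set, so a polynomial that vanishes at no position
  outside \<open>S\<close> has a nonzero derivative of order \<open>n\<close> and thus degree exactly \<open>n\<close>.
\<close>

lemma admissible_is_zero_pattern:
  assumes indep: "affine_alg_independent \<Lambda>" and "length \<Lambda> > 0"
    and adm: "S \<in> admissible (length \<Lambda>) (Suc n)"
  shows "\<exists>P. P \<noteq> 0 \<and> degree P = n \<and> zero_pattern P \<Lambda> = S"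
proof -
  define Z where "Z = {..<length \<Lambda>} \<times> {..<Suc n} - S"
  have "finite Z" by (simp add: Z_def)
  then obtain P where P: "degree P \<le> n" "\<forall>c\<in>S. deriv_at c \<Lambda> P = 0" "\<forall>c\<in>Z. deriv_at c \<Lambda> P \<noteq> 0"
    using exists_poly_avoiding_zeros[of Z n S \<Lambda>]
      exists_poly_separating_position[OF indep assms(2) adm] unfolding Z_def by blast
  have S: "S \<subseteq> {..<length \<Lambda>} \<times> {..<Suc n}" "card {c\<in>S. n \<le> snd c} < Suc n - n"
    using adm by (auto simp: admissible_def)
  have "finite S" using S(1) finite_subset by blast
  then have "{c\<in>S. n \<le> snd c} = {}" using S(2) by simp
  then have "(0, n) \<in> Z" using assms(2) by (auto simp: Z_def)
  then have nz: "(pderiv ^^ n) P \<noteq> 0" using P(3) by force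
  then have "P \<noteq> 0" by auto
  moreover have "degree P = n" using nz higher_pderiv_eq_0_iff[OF \<open>P \<noteq> 0\<close>, of n] P(1) by simp
  moreover have "zero_pattern P \<Lambda> = S"
    using P(2,3) S(1) \<open>degree P = n\<close> unfolding zero_pattern_def Z_def by auto
  ultimately show ?thesis by blast
qed

theorem dope_set_generic:
  assumes "affine_alg_independent \<Lambda>" "length \<Lambda> = m" "m > 0"
  shows "dope_set n \<Lambda> = pattern_matrix m (Suc n) ` admissible m (Suc n)"
proof (intro equalityI subsetI)
  fix M assume "M \<in> dope_set n \<Lambda>"
  then obtain P where "P \<noteq> 0" "degree P = n" "M = dope_matrix P \<Lambda>" by (auto simp: dope_set_def)
  then show "M \<in> pattern_matrix m (Suc n) ` admissible m (Suc n)"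
    using zero_pattern_admissible[OF assms(1), of P] assms(2) by (auto simp: dope_matrix_eq_pattern_matrix)
next
  fix M assume "M \<in> pattern_matrix m (Suc n) ` admissible m (Suc n)"
  then obtain S where S: "S \<in> admissible m (Suc n)" "M = pattern_matrix m (Suc n) S" by blast
  obtain P where P: "P \<noteq> 0" "degree P = n" "zero_pattern P \<Lambda> = S"
    using admissible_is_zero_pattern[OF assms(1), of S n] S(1) assms(2,3) by auto
  then have "M = dope_matrix P \<Lambda>"
    using S(2) assms(2) by (simp add: dope_matrix_eq_pattern_matrix)
  then show "M \<in> dope_set n \<Lambda>" using P(1,2) unfolding dope_set_def by blast
qed

corollary dope_gen_eq:
  assumes "m > 0"
  shows "dope_gen n m = pattern_matrix m (Suc n) ` admissible m (Suc n)"
  unfolding dope_gen_def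
proof (rule the_equality)
  show "\<forall>\<Lambda>. length \<Lambda> = m \<and> distinct \<Lambda> \<and> affine_alg_independent \<Lambda> \<longrightarrow>
      dope_set n \<Lambda> = pattern_matrix m (Suc n) ` admissible m (Suc n)"
    using dope_set_generic assms by blast
  fix D assume D: "\<forall>\<Lambda>. length \<Lambda> = m \<and> distinct \<Lambda> \<and> affine_alg_independent \<Lambda> \<longrightarrow> dope_set n \<Lambda> = D"
  obtain \<Lambda> where "length \<Lambda> = m" "distinct \<Lambda>" "affine_alg_independent \<Lambda>"
    using exists_affine_alg_independent by blast
  then show "D = pattern_matrix m (Suc n) ` admissible m (Suc n)"
    using D dope_set_generic assms by metis
qed

theorem theorem1p2:
  fixes m n :: nat
  assumes "m > 0" and "n > 0"
  shows "(\<forall>k \<le> n. real (card {M \<in> dope_gen n m. num_ones M = k}) =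
            (real n + 1 - real k) / (real n + 1) * real (((n + 1) * m) choose k)) \<and>
         int (card (dope_gen n m)) =
            int (((n + 1) * m - 1) choose n)
            - (int m - 2) * (\<Sum>k = 0..<n. int (((n + 1) * m - 1) choose k))"
proof -
  define \<A> where "\<A> = admissible m (Suc n)"
  have sub: "\<A> \<subseteq> Pow ({..<m} \<times> {..<Suc n})" by (auto simp: \<A>_def admissible_def)
  then have fin: "finite \<A>" by (rule finite_subset) simp
  have inj: "inj_on (pattern_matrix m (Suc n)) \<A>" by (rule inj_on_subset[OF inj_on_pattern_matrix sub])
  have gen: "dope_gen n m = pattern_matrix m (Suc n) ` \<A>" by (simp add: \<A>_def dope_gen_eq[OF assms(1)])
  have count: "int (card {S\<in>\<A>. card S = k}) = ballot_number m (Suc n) k" if "k \<le> n" for k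
    unfolding \<A>_def using that by (intro card_admissible) simp
  have "real (card {M \<in> dope_gen n m. num_ones M = k}) =
      (real n + 1 - real k) / (real n + 1) * real (((n + 1) * m) choose k)" if "k \<le> n" for k
  proof -
    have "num_ones (pattern_matrix m (Suc n) S) = card S" if "S \<in> \<A>" for S
      using that sub by (intro num_ones_pattern_matrix) auto
    then have "{M \<in> dope_gen n m. num_ones M = k} = pattern_matrix m (Suc n) ` {S\<in>\<A>. card S = k}"
      unfolding gen by auto
    then have "card {M \<in> dope_gen n m. num_ones M = k} = card {S\<in>\<A>. card S = k}"
      by (simp add: card_image inj_on_subset[OF inj])
    then have "real (card {M \<in> dope_gen n m. num_ones M = k}) = real_of_int (ballot_number m (Suc n) k)"
      using count[OF that] by (metis of_int_of_nat_eq)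
    then show ?thesis by (simp add: ballot_number_real add.commute)
  qed
  moreover have "int (card (dope_gen n m)) =
      int (((n + 1) * m - 1) choose n) - (int m - 2) * (\<Sum>k = 0..<n. int (((n + 1) * m - 1) choose k))"
  proof -
    have "card S \<le> n" if "S \<in> \<A>" for S
    proof -
      have "card {c\<in>S. 0 \<le> snd c} < Suc n - 0" using that unfolding \<A>_def admissible_def by blast
      then show ?thesis by simp
    qed
    then have "(\<Sum>k\<le>n. \<Sum>S\<in>{S\<in>\<A>. card S = k}. 1 :: nat) = (\<Sum>S\<in>\<A>. 1)"
      using fin by (intro sum.group) auto
    then have "card \<A> = (\<Sum>k\<le>n. card {S\<in>\<A>. card S = k})" by simp
    then have "int (card (dope_gen n m)) = (\<Sum>k\<le>n. ballot_number m (Suc n) k)"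
      using card_image[OF inj] count unfolding gen by simp
    then show ?thesis using sum_ballot_number[OF assms(1), of "Suc n" n] by simp
  qed
  ultimately show ?thesis by blast
qed

end
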